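(* Let $p\in\mathbb{N}$, $p\ge 1$, and let $J=(a_{i,j})_{i,j\ge 0}$ be an infinite $(p+2)$-banded lower Hessenberg matrix whose entries depend on $t\in\mathbb{R}$, with $a_{i,i+1}=1$ for all $i\ge 0$ and $a_{i,j}=0$ if $j>i+1$ or $i>j+p$. Assume that $J$ is a solution of the full Kostant-Toda lattice $$\dot a_{i,j}=(a_{i,i}-a_{j,j})a_{i,j}+a_{i+1,j}-a_{i,j-1},\qquad i,j=0,1,\ldots,$$ that $a_{p+i,i}\neq 0$ for $i=0,1,\ldots$, and let $C\in\mathbb{C}$ be such that $\det(J_n-CI_n)\neq 0$ for every $n\in\mathbb{N}$. Then there exist $p$ solutions $J^{(1)},\ldots,J^{(p)}$ of the full Kostant-Toda lattice, and matrices $U,L^{(1)},\ldots,L^{(p)}$ of the form $$U=\begin{pmatrix}\gamma_1&1&&\\&\gamma_{p+2}&1&\\&&\gamma_{2p+3}&\ddots\\&&&\ddots\end{pmatrix},\qquad L^{(i)}=\begin{pmatrix}1&&&\\\gamma_{i+1}&1&&\\&\gamma_{p+i+2}&1&\\&&\gamma_{2p+i+3}&\ddots\\&&&\ddots\end{pmatrix},\quad i=1,\ldots,p,$$ such that, writing $J^{(0)}=J$, $$J^{(i)}=CI+L^{(i+1)}\cdots L^{(p)}\,U\,L^{(1)}\cdots L^{(i)},\qquad i=0,1,\ldots,p$$ (for $i=0$ the product is $L^{(1)}\cdots L^{(p)}U$ and for $i=p$ it is $UL^{(1)}\cdots L^{(p)}$). Moreover, the sequence $\{\gamma_n\}_{n\ge1}$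 formed by the entries of $U,L^{(1)},\ldots,L^{(p)}$ defines a solution $\Gamma$ of the discrete Korteweg-de Vries equation $$\dot\gamma_n=\gamma_n\left(\sum_{i=1}^{p}\gamma_{n+i}-\sum_{i=1}^{p}\gamma_{n-i}\right),\qquad n\in\mathbb{N}.$$
   Context: The dot denotes $d/dt$, $t\in\mathbb{R}$, and the explicit $t$-dependence is suppressed. $I$ is the infinite identity matrix. For an infinite matrix $M$, $M_n$ is the finite matrix formed by its first $n$ rows and columns. Entries with a negative index are $0$ ($a_{i,-1}=0$), and $\gamma_n\equiv 0$ for $n\le 0$. A $(p+2)$-banded lower Hessenberg matrix $J$ (with $a_{i,i+1}=1$ and $a_{i,j}=0$ for $j>i+1$ or $i>j+p$) is called a solution of the full Kostant-Toda lattice if: (1) for each $j=0,1,\ldots$ the entries $a_{i,j}=a_{i,j}(t)$, $i=j,j+1,\ldots,j+p$, are continuous complex-valued functions defined in an open interval $\mathcal{I}_j\subset\mathbb{R}$, with $\bigcap_{j=0}^{N}\mathcal{I}_j\neq\emptyset$ for every $N\in\mathbb{N}$; and (2) the entries satisfy the equations of the lattice (each equation holding where all the functions in it are defined). Associated with a sequence $\{\gamma_n\}_{n\ge 1}$, $\Gamma$ is the infinite matrix (rows and columns indexed from $0$) with $1$'s on the superdiagonal, entries $\gamma_1,\gamma_2,\ldots$ on the $p$-th subdiagonal ($\Gamma_{p+n-1,n-1}=\gamma_n$), and zeros elsewhere. $\Gamma$ is called a solution of the discrete Korteweg-de Vries equation if each $\gamma_j=\gamma_j(t)$ is a continuous complex-valued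 function on an open interval $\mathcal{O}_j\subset\mathbb{R}$, with $\bigcap_{j=1}^{N}\mathcal{O}_j\neq\emptyset$ for every $N\in\mathbb{N}$, and the equation holds for every $n$ (where all the functions in it are defined). The entries of $U$ and $L^{(i)}$ are, explicitly, with rows and columns indexed from $0$: $U_{m,m}=\gamma_{m(p+1)+1}$, $U_{m,m+1}=1$; $L^{(i)}_{m,m}=1$, $L^{(i)}_{m+1,m}=\gamma_{m(p+1)+i+1}$, for $m=0,1,\ldots$; all other entries are $0$. The hypotheses $a_{p+i,i}\ne0$ and $\det(J_n-CI_n)\neq0$ are understood for the values of $t$ at which the functions involved are defined. Identities between infinite $t$-dependent matrices are understood entrywise in the formal sense: for each $N\in\mathbb{N}$ there is a nonempty open interval of $t$ (which may depend on $N$) on which all the entries with indices at most $N$ of the matrices involved are defined and satisfy the identity. *)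

theory Defs
  imports "HOL-Analysis.Analysis" "Jordan_Normal_Form.Determinant"
begin

section \<open>Infinite matrices\<close>

type_synonym 'a imat = "nat \<Rightarrow> nat \<Rightarrow> 'a"

definition one_imat :: "complex imat" where
  "one_imat i j = (if i = j then 1 else 0)"

text \<open>Only products whose left factor has finitely many nonzero entries in each row are used,
  so the series below are finite sums.\<close>

definition times_imat :: "complex imat \<Rightarrow> complex imat \<Rightarrow> complex imat" where
  "times_imat A B i j = (\<Sum>k. A i k * B k j)"

definition prod_imats :: "complex imat list \<Rightarrow> complex imat" where
  "prod_imats As = foldr times_imat As one_imat"

text \<open>The finite matrix formed by the first \<open>n\<close> rows and columns.\<close>

definition leading :: "complex imat \<Rightarrow> nat \<Rightarrow> complex Matrix.mat" where
  "leading A n = Matrix.mat n n (\<lambda>(i, j). A i j)"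

definition banded_hessenberg :: "nat \<Rightarrow> complex imat \<Rightarrow> bool" where
  "banded_hessenberg p A \<longleftrightarrow>
     (\<forall>i. A i (i + 1) = 1) \<and> (\<forall>i j. j > i + 1 \<or> i > j + p \<longrightarrow> A i j = 0)"

section \<open>Open intervals of time\<close>

text \<open>Bounded or unbounded, and possibly empty; nonemptiness is always stated separately.\<close>

definition open_interval :: "real set \<Rightarrow> bool" where
  "open_interval S \<longleftrightarrow> open S \<and> is_interval S"

section \<open>The full Kostant-Toda lattice\<close>

text \<open>Partially defined functions of \<open>t\<close> are total functions together with a domain; values outside
  the domain are irrelevant.  The entries of column \<open>j\<close> in rows \<open>j, \<dots>, j + p\<close> live on the interval
  \<open>D j\<close>, whereas the remaining entries of the column are the constants \<open>0\<close> and \<open>1\<close>, defined for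
  all \<open>t\<close>.\<close>

definition entry_dom :: "nat \<Rightarrow> (nat \<Rightarrow> real set) \<Rightarrow> nat \<Rightarrow> nat \<Rightarrow> real set" where
  "entry_dom p D i j = (if j \<le> i \<and> i \<le> j + p then D j else UNIV)"

text \<open>The set of times at which every function occurring in the \<open>(i, j)\<close> equation of the lattice is
  defined.\<close>

definition KT_eq_dom :: "nat \<Rightarrow> (nat \<Rightarrow> real set) \<Rightarrow> nat \<Rightarrow> nat \<Rightarrow> real set" where
  "KT_eq_dom p D i j =
     entry_dom p D i j \<inter> entry_dom p D i i \<inter> entry_dom p D j j \<inter> entry_dom p D (i + 1) j \<inter>
     (if j = 0 then UNIV else entry_dom p D i (j - 1))"

definition KT_solution :: "nat \<Rightarrow> (real \<Rightarrow> complex imat) \<Rightarrow> (nat \<Rightarrow> real set) \<Rightarrow> bool" where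
  "KT_solution p J D \<longleftrightarrow>
     (\<forall>t. banded_hessenberg p (J t)) \<and>
     (\<forall>j. open_interval (D j)) \<and>
     (\<forall>N. (\<Inter>j\<le>N. D j) \<noteq> {}) \<and>
     (\<forall>j. \<forall>i\<in>{j..j + p}. continuous_on (D j) (\<lambda>t. J t i j)) \<and>
     (\<forall>i j. \<forall>t\<in>KT_eq_dom p D i j.
        ((\<lambda>s. J s i j) has_vector_derivative
           ((J t i i - J t j j) * J t i j + J t (i + 1) j - (if j = 0 then 0 else J t i (j - 1))))
        (at t))"

section \<open>The discrete Korteweg-de Vries equation\<close>

text \<open>Sequences \<open>\<gamma>\<^sub>1, \<gamma>\<^sub>2, \<dots>\<close> are functions on \<open>nat\<close> whose value at \<open>0\<close> is never used.\<close>

definition Gamma_mat :: "nat \<Rightarrow> (nat \<Rightarrow> complex) \<Rightarrow> complex imat" where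
  "Gamma_mat p g i j = (if j = i + 1 then 1 else if i = j + p then g (j + 1) else 0)"

text \<open>The sum over \<open>\<gamma>\<^sub>n\<^sub>-\<^sub>i\<close> is restricted to \<open>i < n\<close>, because \<open>\<gamma>\<^sub>k\<close> vanishes identically for
  \<open>k \<le> 0\<close>; the index set \<open>{k. 1 \<le> k \<and> n \<le> k + p \<and> k \<le> n + p}\<close> is that of the functions occurring
  in the \<open>n\<close>-th equation.\<close>

definition dKdV_solution :: "nat \<Rightarrow> (real \<Rightarrow> complex imat) \<Rightarrow> (nat \<Rightarrow> real set) \<Rightarrow> bool" where
  "dKdV_solution p G E \<longleftrightarrow>
     (\<exists>\<gamma> :: real \<Rightarrow> nat \<Rightarrow> complex.
        (\<forall>t. G t = Gamma_mat p (\<gamma> t)) \<and>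
        (\<forall>n\<ge>1. open_interval (E n)) \<and>
        (\<forall>N. (\<Inter>n\<in>{1..N}. E n) \<noteq> {}) \<and>
        (\<forall>n\<ge>1. continuous_on (E n) (\<lambda>t. \<gamma> t n)) \<and>
        (\<forall>n\<ge>1. \<forall>t\<in>(\<Inter>k\<in>{k. 1 \<le> k \<and> n \<le> k + p \<and> k \<le> n + p}. E k).
           ((\<lambda>s. \<gamma> s n) has_vector_derivative
              (\<gamma> t n * ((\<Sum>i=1..p. \<gamma> t (n + i)) - (\<Sum>i=1..p. if i < n then \<gamma> t (n - i) else 0))))
           (at t)))"

section \<open>The bidiagonal factors\<close>

definition U_mat :: "nat \<Rightarrow> (nat \<Rightarrow> complex) \<Rightarrow> complex imat" where
  "U_mat p g i j = (if j = i then g (i * (p + 1) + 1) else if j = i + 1 then 1 else 0)"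

definition L_mat :: "nat \<Rightarrow> (nat \<Rightarrow> complex) \<Rightarrow> nat \<Rightarrow> complex imat" where
  "L_mat p g k i j = (if i = j then 1 else if i = j + 1 then g (j * (p + 1) + k + 1) else 0)"

text \<open>\<open>C I + L\<^sup>(\<^sup>k\<^sup>+\<^sup>1\<^sup>) \<cdots> L\<^sup>(\<^sup>p\<^sup>) U L\<^sup>(\<^sup>1\<^sup>) \<cdots> L\<^sup>(\<^sup>k\<^sup>)\<close>\<close>

definition Darboux_mat :: "nat \<Rightarrow> complex \<Rightarrow> (nat \<Rightarrow> complex) \<Rightarrow> nat \<Rightarrow> complex imat" where
  "Darboux_mat p C g k i j =
     C * one_imat i j +
     prod_imats (map (L_mat p g) [k + 1..<p + 1] @ [U_mat p g] @ map (L_mat p g) [1..<k + 1]) i j"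

text \<open>Formal equality, for \<open>k = 0, \<dots>, p\<close>, of \<open>K k\<close> (column \<open>j\<close> defined on \<open>D k j\<close>) and the above
  matrix built from \<open>\<gamma>\<close> (\<open>\<gamma>\<^sub>n\<close> defined on \<open>E n\<close>).  The products' entries with indices at most \<open>N\<close>,
  as well as those of the factors, are polynomials in \<open>\<gamma>\<^sub>1, \<dots>, \<gamma>\<^sub>m\<close> with \<open>m = (N + 1) (p + 1)\<close>;
  already the \<open>(N, N)\<close> entry for \<open>k = p\<close> involves \<open>\<gamma>\<^sub>m\<close>.\<close>

definition formal_Darboux_identities ::
  "nat \<Rightarrow> complex \<Rightarrow> (nat \<Rightarrow> real \<Rightarrow> complex imat) \<Rightarrow> (nat \<Rightarrow> nat \<Rightarrow> real set) \<Rightarrow>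
   (real \<Rightarrow> nat \<Rightarrow> complex) \<Rightarrow> (nat \<Rightarrow> real set) \<Rightarrow> bool" where
  "formal_Darboux_identities p C K D \<gamma> E \<longleftrightarrow>
     (\<forall>N. \<exists>W. open_interval W \<and> W \<noteq> {} \<and>
        W \<subseteq> (\<Inter>n\<in>{1..(N + 1) * (p + 1)}. E n) \<and>
        (\<forall>k\<le>p. W \<subseteq> (\<Inter>j\<le>N. D k j) \<and>
           (\<forall>t\<in>W. \<forall>i\<le>N. \<forall>j\<le>N. K k t i j = Darboux_mat p C (\<gamma> t) k i j)))"

end

(* A dKdV solution is a one-parameter flow of the bidiagonal factors: each factor obeys a Lax equation
   A' = (S + b) A - A (S + b'), with S the shift and b, b' the diagonals of the two neighbouring
   J^(k).  Starting from X = J - C I, one subdiagonal is split off at a time.  A left null vector y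
   of X, transported by y' = - y (S + b), gives the factor L with subdiagonal - y_m / y_(m+1), and
   X = L X1 where X1 has one subdiagonal fewer and again obeys a Lax equation.  After p steps the
   upper bidiagonal U remains.

   The entries y_m must not vanish anywhere on their domains, because the domains of the entries of
   J may shrink towards a point outside all of them.  The conditions on det (J_n - C I_n) guarantee
   that at each time some null vector has y_m nonzero; the bad coefficients of a combination
   f + c g are the values of the differentiable curve - f / g in the complex plane, a null set, so
   generic coefficients avoid all zeros for all times and all m at once. *)

theory Submission
  imports Defs
begin

text \<open>For p \<ge> 2 the conditions at a fixed time do not determine the single factors L: each
  splitting leaves the initial values of y free, and the choice of y exploits this freedom. A
  splitting changes only the left diagonal of the Lax equation; the right one remains that of J, so
  the diagonals met on the way close up into a cycle, and the cyclic products obey Lax equations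
  with equal diagonals on both sides. Entries that are constantly 1 turn their Lax equations into
  algebraic relations. In particular, the superdiagonal of U links the diagonals of the last and the
  first matrix, and every diagonal entry becomes C plus a sum of p + 1 consecutive values of
  \<gamma>; the discrete KdV equation is a difference of two such sums. Since a row of a product
  uses later rows of its factors, everything is stated row by row on decreasing domains.\<close>

section \<open>Banded infinite matrices\<close>

text \<open>One notion for the unit lower triangular factors (c = 0) and the Hessenberg matrices (c
  = 1). Ones on the outermost diagonal survive multiplication, and rows are finite, so products are
  finite sums.\<close>

definition hess :: "nat \<Rightarrow> nat \<Rightarrow> complex imat \<Rightarrow> bool" where
  "hess c r A \<longleftrightarrow> (\<forall>i. A i (i + c) = 1) \<and> (\<forall>i j. j > i + c \<or> i > j + r \<longrightarrow> A i j = 0)"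

lemma hess_diag: "hess c r A \<Longrightarrow> A i (i + c) = 1"
  by (simp add: hess_def)

lemma hess_zero: "hess c r A \<Longrightarrow> j > i + c \<or> i > j + r \<Longrightarrow> A i j = 0"
  unfolding hess_def by blast

lemma banded_hessenberg_iff_hess: "banded_hessenberg p A \<longleftrightarrow> hess 1 p A"
  by (simp add: banded_hessenberg_def hess_def)

lemma hess_one: "hess 0 0 one_imat"
  by (auto simp: hess_def one_imat_def)

lemma hess_L: "hess 0 1 (L_mat p g k)"
  by (auto simp: hess_def L_mat_def)

lemma hess_U: "hess 1 0 (U_mat p g)"
  by (auto simp: hess_def U_mat_def)

lemma times_imat_eq_sum:
  assumes "hess c r A" "n \<ge> i + c"
  shows "times_imat A B i j = (\<Sum>k\<le>n. A i k * B k j)"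
  unfolding times_imat_def
  by (rule suminf_finite) (use assms in \<open>auto simp: hess_zero\<close>)

lemma hess_times:
  assumes A: "hess c r A" and B: "hess c' r' B"
  shows "hess (c + c') (r + r') (times_imat A B)"
  unfolding hess_def
proof (intro conjI allI impI)
  fix i
  have "times_imat A B i (i + (c + c')) = (\<Sum>k\<le>i + c. A i k * B k (i + (c + c')))"
    using times_imat_eq_sum[OF A order_refl] .
  also have "\<dots> = (\<Sum>k\<in>{i + c}. A i k * B k (i + (c + c')))"
    by (rule sum.mono_neutral_right) (auto intro!: hess_zero[OF B])
  also have "\<dots> = 1"
    using hess_diag[OF A, of i] hess_diag[OF B, of "i + c"] by (simp add: add.assoc)
  finally show "times_imat A B i (i + (c + c')) = 1" .
next
  fix i j assume h: "i + (c + c') < j \<or> j + (r + r') < i"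
  have "A i k * B k j = 0" if "k \<le> i + c" for k
  proof (cases "i > k + r")
    case True
    then show ?thesis using hess_zero[OF A] by simp
  next
    case False
    then have "j > k + c' \<or> k > j + r'" using h that by linarith
    then show ?thesis using hess_zero[OF B] by simp
  qed
  then have "(\<Sum>k\<le>i + c. A i k * B k j) = 0"
    by (intro sum.neutral) auto
  then show "times_imat A B i j = 0"
    by (simp add: times_imat_eq_sum[OF A order_refl])
qed

lemma times_imat_assoc:
  assumes A: "hess c r A" and B: "hess c' r' B"
  shows "times_imat (times_imat A B) M = times_imat A (times_imat B M)"
proof (intro ext)
  fix i j
  have "times_imat (times_imat A B) M i j
      = (\<Sum>k\<le>i + (c + c'). (\<Sum>l\<le>i + c. A i l * B l k) * M k j)"
    by (simp add: times_imat_eq_sum[OF hess_times[OF A B] order_refl]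
        times_imat_eq_sum[OF A order_refl])
  also have "\<dots> = (\<Sum>l\<le>i + c. A i l * (\<Sum>k\<le>i + (c + c'). B l k * M k j))"
    unfolding sum_distrib_right sum_distrib_left
    by (subst sum.swap) (simp add: mult.assoc)
  also have "\<dots> = (\<Sum>l\<le>i + c. A i l * times_imat B M l j)"
    by (rule sum.cong[OF refl], subst times_imat_eq_sum[OF B, of _ "i + (c + c')"]) auto
  also have "\<dots> = times_imat A (times_imat B M) i j"
    by (simp add: times_imat_eq_sum[OF A order_refl])
  finally show "times_imat (times_imat A B) M i j = times_imat A (times_imat B M) i j" .
qed

lemma times_one_left: "times_imat one_imat A = A"
proof (intro ext)
  fix i j
  have "times_imat one_imat A i j = (\<Sum>k\<le>i. one_imat i k * A k j)"
    using times_imat_eq_sum[OF hess_one, of i i] by simp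
  also have "\<dots> = (\<Sum>k\<le>i. if i = k then A k j else 0)"
    by (rule sum.cong) (auto simp: one_imat_def)
  finally show "times_imat one_imat A i j = A i j" by simp
qed

lemma times_one_right:
  assumes "hess c r A"
  shows "times_imat A one_imat = A"
proof (intro ext)
  fix i j
  have "times_imat A one_imat i j = (\<Sum>k\<le>i + c. A i k * one_imat k j)"
    using times_imat_eq_sum[OF assms order_refl] .
  also have "\<dots> = (\<Sum>k\<le>i + c. if k = j then A i k else 0)"
    by (rule sum.cong) (auto simp: one_imat_def)
  also have "\<dots> = A i j"
    using hess_zero[OF assms, of i j] by simp
  finally show "times_imat A one_imat i j = A i j" .
qed

lemma times_L_left:
  "times_imat (L_mat p g k) A i j =
     A i j + (if i = 0 then 0 else L_mat p g k i (i - 1) * A (i - 1) j)"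
proof -
  have "times_imat (L_mat p g k) A i j = (\<Sum>l\<le>i. L_mat p g k i l * A l j)"
    using times_imat_eq_sum[OF hess_L, of i i] by simp
  also have "\<dots> = (\<Sum>l\<in>{i, i - 1}. L_mat p g k i l * A l j)"
    by (rule sum.mono_neutral_right) (auto simp: L_mat_def)
  finally show ?thesis by (cases i) (auto simp: L_mat_def)
qed

lemma times_L_right:
  assumes "hess c r A"
  shows "times_imat A (L_mat p g k) i j = A i j + A i (Suc j) * L_mat p g k (Suc j) j"
proof -
  have "times_imat A (L_mat p g k) i j = (\<Sum>l\<le>i + c + Suc j. A i l * L_mat p g k l j)"
    by (rule times_imat_eq_sum[OF assms]) simp
  also have "\<dots> = (\<Sum>l\<in>{j, Suc j}. A i l * L_mat p g k l j)"
    by (rule sum.mono_neutral_right) (auto simp: L_mat_def)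
  finally show ?thesis by (auto simp: L_mat_def)
qed

lemma prod_imats_Nil [simp]: "prod_imats [] = one_imat"
  and prod_imats_Cons [simp]: "prod_imats (A # As) = times_imat A (prod_imats As)"
  by (simp_all add: prod_imats_def)

lemma hess_prod_imats:
  assumes "\<And>A. A \<in> set As \<Longrightarrow> \<exists>c r. hess c r A"
  shows "\<exists>c r. hess c r (prod_imats As)"
  using assms
proof (induction As)
  case Nil
  then show ?case using hess_one by auto
next
  case (Cons A As)
  have "\<exists>c r. hess c r A" "\<exists>c r. hess c r (prod_imats As)"
    using Cons.prems by (auto intro!: Cons.IH)
  then show ?case using hess_times by (metis prod_imats_Cons)
qed

lemma prod_imats_append:
  assumes "\<And>A. A \<in> set As \<Longrightarrow> \<exists>c r. hess c r A"
  shows "prod_imats (As @ Bs) = times_imat (prod_imats As) (prod_imats Bs)"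
  using assms
proof (induction As)
  case Nil
  then show ?case by (simp add: times_one_left)
next
  case (Cons A As)
  obtain c r where A: "hess c r A" using Cons.prems[of A] by auto
  obtain c' r' where As: "hess c' r' (prod_imats As)"
    using hess_prod_imats[of As] Cons.prems by auto
  show ?case using Cons times_imat_assoc[OF A As] by simp
qed

section \<open>Products of the bidiagonal factors in cyclic order\<close>

definition L_prod :: "nat \<Rightarrow> (nat \<Rightarrow> complex) \<Rightarrow> nat \<Rightarrow> nat \<Rightarrow> complex imat" where
  "L_prod p g a b = prod_imats (map (L_mat p g) [a + 1..<b + 1])"

lemma L_prod_refl [simp]: "L_prod p g a a = one_imat"
  by (simp add: L_prod_def)

lemma L_prod_rec_left:
  "a < b \<Longrightarrow> L_prod p g a b = times_imat (L_mat p g (Suc a)) (L_prod p g (Suc a) b)"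
  by (simp add: L_prod_def upt_conv_Cons del: upt_Suc)

lemma L_prod_rec_right:
  assumes "a \<le> b"
  shows "L_prod p g a (Suc b) = times_imat (L_prod p g a b) (L_mat p g (Suc b))"
proof -
  have "L_prod p g a (Suc b) = prod_imats (map (L_mat p g) [a + 1..<b + 1] @ [L_mat p g (Suc b)])"
    using assms by (simp add: L_prod_def)
  also have "\<dots> = times_imat (L_prod p g a b) (times_imat (L_mat p g (Suc b)) one_imat)"
    by (subst prod_imats_append) (auto simp: L_prod_def intro: hess_L)
  finally show ?thesis by (simp add: times_one_right[OF hess_L])
qed

lemma hess_L_prod: "a \<le> b \<Longrightarrow> hess 0 (b - a) (L_prod p g a b)"
proof (induction b rule: dec_induct)
  case base
  then show ?case by (simp add: hess_one)
next
  case (step n)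
  then show ?case
    using hess_times[OF step.IH hess_L, of p g "Suc n"]
    by (simp add: L_prod_rec_right Suc_diff_le)
qed

text \<open>This is J^(k) - C I, bracketed around U because the diagonals in the Lax equations run
  from k up to p before U and from 0 up to k after it.\<close>

definition cyc_prod :: "nat \<Rightarrow> (nat \<Rightarrow> complex) \<Rightarrow> nat \<Rightarrow> complex imat" where
  "cyc_prod p g k = times_imat (L_prod p g k p) (times_imat (U_mat p g) (L_prod p g 0 k))"

lemma Darboux_mat_eq:
  assumes "k \<le> p"
  shows "Darboux_mat p C g k i j = C * one_imat i j + cyc_prod p g k i j"
proof -
  have "prod_imats (map (L_mat p g) [k + 1..<p + 1] @ [U_mat p g] @ map (L_mat p g) [1..<k + 1])
      = cyc_prod p g k"
    unfolding cyc_prod_def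
    by (subst prod_imats_append) (auto simp: L_prod_def intro: hess_L)
  then show ?thesis by (simp add: Darboux_mat_def)
qed

lemma hess_U_L_prod: "hess 1 k (times_imat (U_mat p g) (L_prod p g 0 k))"
  using hess_times[OF hess_U hess_L_prod[of 0 k]] by simp

lemma hess_cyc_prod:
  assumes "k \<le> p"
  shows "hess 1 p (cyc_prod p g k)"
proof -
  have "hess (0 + 1) (p - k + k) (cyc_prod p g k)"
    unfolding cyc_prod_def by (rule hess_times[OF hess_L_prod[OF assms] hess_U_L_prod])
  then show ?thesis using assms by simp
qed

lemma banded_hessenberg_Darboux_mat:
  assumes "p \<ge> 1" "k \<le> p"
  shows "banded_hessenberg p (Darboux_mat p C g k)"
  using hess_cyc_prod[OF assms(2), of g] assms
  by (auto simp: banded_hessenberg_iff_hess hess_def Darboux_mat_eq one_imat_def)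

text \<open>Two consecutive cyclic products are \<open>L Z\<close> and \<open>Z L\<close> with \<open>L = L\<^sup>(\<^sup>k\<^sup>+\<^sup>1\<^sup>)\<close>, and the
  superdiagonal of \<open>Z\<close> consists of ones.\<close>

lemma cyc_prod_diag_Suc:
  assumes "k < p"
  shows "cyc_prod p g (Suc k) m m =
    cyc_prod p g k m m + L_mat p g (Suc k) (Suc m) m
      - (if m = 0 then 0 else L_mat p g (Suc k) m (m - 1))"
proof -
  let ?L = "L_mat p g (Suc k)"
  define Z where "Z = times_imat (L_prod p g (Suc k) p) (times_imat (U_mat p g) (L_prod p g 0 k))"
  have hF: "hess 0 (p - Suc k) (L_prod p g (Suc k) p)"
    using assms by (intro hess_L_prod) simp
  note hUG = hess_U_L_prod[of k p g]
  have hZ: "hess 1 (p - Suc k + k) Z"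
    unfolding Z_def using hess_times[OF hF hUG] by simp
  have "cyc_prod p g k = times_imat ?L Z"
    unfolding cyc_prod_def Z_def L_prod_rec_left[OF assms]
    using times_imat_assoc[OF hess_L hF] .
  moreover have "cyc_prod p g (Suc k) = times_imat Z ?L"
  proof -
    have "times_imat (U_mat p g) (L_prod p g 0 (Suc k))
        = times_imat (times_imat (U_mat p g) (L_prod p g 0 k)) ?L"
      using times_imat_assoc[OF hess_U hess_L_prod[of 0 k]] by (simp add: L_prod_rec_right)
    then show ?thesis
      unfolding cyc_prod_def Z_def times_imat_assoc[OF hF hUG] by simp
  qed
  ultimately show ?thesis
    using hess_diag[OF hZ, of m] hess_diag[OF hZ, of "m - 1"]
    by (cases m) (simp_all add: times_L_left times_L_right[OF hZ])
qed

section \<open>Lax equations for products\<close>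

text \<open>Row \<open>i\<close> of \<open>A' = (S + b) A - A (S + b')\<close> at time \<open>t\<close>, where \<open>S\<close> is the shift with ones on the
  superdiagonal and \<open>b, b'\<close> are diagonal matrices.\<close>

definition lax_at :: "real \<Rightarrow> nat \<Rightarrow> (real \<Rightarrow> complex imat) \<Rightarrow> (nat \<Rightarrow> complex) \<Rightarrow>
    (nat \<Rightarrow> complex) \<Rightarrow> bool" where
  "lax_at t i A b b' \<longleftrightarrow> (\<forall>j. ((\<lambda>s. A s i j) has_vector_derivative
     (b i * A t i j + A t (Suc i) j - A t i j * b' j - (if j = 0 then 0 else A t i (j - 1)))) (at t))"

lemma lax_at_one: "lax_at t i (\<lambda>s. one_imat) b b"
proof -
  have "b i * one_imat i j + one_imat (Suc i) j - one_imat i j * b j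
      - (if j = 0 then 0 else one_imat i (j - 1)) = 0" for j
    by (auto simp: one_imat_def)
  then show ?thesis by (simp add: lax_at_def)
qed

text \<open>The terms with S + b' cancel between the two factors. Row i of \<open>A\<close> reaches
  column i + 1 at most, which is why \<open>B\<close> is needed up to row i + 1.\<close>

lemma lax_at_times:
  assumes c: "c \<le> 1" and A: "\<And>s. hess c r (A s)" and lA: "lax_at t i A b b'"
    and lB: "\<And>k. k \<le> Suc i \<Longrightarrow> lax_at t k B b' b''"
  shows "lax_at t i (\<lambda>s. times_imat (A s) (B s)) b b''"
  unfolding lax_at_def
proof
  fix j :: nat
  let ?d = "if j = 0 then 0 else 1 :: complex"
  have tm: "times_imat (A s) (B s) i' j' = (\<Sum>k\<le>n. A s i' k * B s k j')" if "n \<ge> Suc i'" for s i' j' n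
    using times_imat_eq_sum[OF A] c that by simp
  have "((\<lambda>s. \<Sum>k\<le>Suc i. A s i k * B s k j) has_vector_derivative
      (\<Sum>k\<le>Suc i. A t i k * (b' k * B t k j + B t (Suc k) j - B t k j * b'' j - (if j = 0 then 0 else B t k (j - 1)))
         + (b i * A t i k + A t (Suc i) k - A t i k * b' k - (if k = 0 then 0 else A t i (k - 1))) * B t k j)) (at t)"
    by (intro has_vector_derivative_sum has_vector_derivative_mult)
      (use lA lB in \<open>auto simp: lax_at_def\<close>)
  also have "(\<Sum>k\<le>Suc i. A t i k * (b' k * B t k j + B t (Suc k) j - B t k j * b'' j - (if j = 0 then 0 else B t k (j - 1)))
         + (b i * A t i k + A t (Suc i) k - A t i k * b' k - (if k = 0 then 0 else A t i (k - 1))) * B t k j)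
     = (\<Sum>k\<le>Suc i. b i * (A t i k * B t k j) - (A t i k * B t k j) * b'' j - ?d * (A t i k * B t k (j - 1))
         + A t (Suc i) k * B t k j
         + (A t i k * B t (Suc k) j - (if k = 0 then 0 else A t i (k - 1) * B t k j)))"
    by (rule sum.cong) (auto simp: algebra_simps)
  also have "\<dots> = b i * (\<Sum>k\<le>Suc i. A t i k * B t k j) - (\<Sum>k\<le>Suc i. A t i k * B t k j) * b'' j
      - ?d * (\<Sum>k\<le>Suc i. A t i k * B t k (j - 1)) + (\<Sum>k\<le>Suc i. A t (Suc i) k * B t k j)
      + (\<Sum>k\<le>Suc i. A t i k * B t (Suc k) j - (if k = 0 then 0 else A t i (k - 1) * B t k j))"
    by (simp only: sum.distrib sum_subtractf sum_distrib_left sum_distrib_right)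
  \<comment> \<open>The two contributions of the shift between the factors telescope and leave one
    boundary term.\<close>
  also have "(\<Sum>k\<le>Suc i. A t i k * B t (Suc k) j - (if k = 0 then 0 else A t i (k - 1) * B t k j))
      = A t i (Suc i) * B t (Suc (Suc i)) j"
  proof -
    have "(\<Sum>k\<le>n. A t i k * B t (Suc k) j - (if k = 0 then 0 else A t i (k - 1) * B t k j))
      = A t i n * B t (Suc n) j" for n
      by (induction n) auto
    then show ?thesis .
  qed
  \<comment> \<open>Both entries are 1 if c = 1 and 0 if c = 0, so the boundary term becomes the
    term k = i + 2 that row i + 1 of the product still lacks.\<close>
  also have "A t i (Suc i) = A t (Suc i) (Suc (Suc i))"
  proof (cases "c = 1")
    case True
    then show ?thesis using hess_diag[OF A, of t i] hess_diag[OF A, of t "Suc i"] by simp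
  next
    case False
    then show ?thesis using c by (simp add: hess_zero[OF A])
  qed
  also have "b i * (\<Sum>k\<le>Suc i. A t i k * B t k j) - (\<Sum>k\<le>Suc i. A t i k * B t k j) * b'' j
      - ?d * (\<Sum>k\<le>Suc i. A t i k * B t k (j - 1)) + (\<Sum>k\<le>Suc i. A t (Suc i) k * B t k j)
      + A t (Suc i) (Suc (Suc i)) * B t (Suc (Suc i)) j
    = b i * times_imat (A t) (B t) i j + times_imat (A t) (B t) (Suc i) j
      - times_imat (A t) (B t) i j * b'' j
      - (if j = 0 then 0 else times_imat (A t) (B t) i (j - 1))"
    by (simp add: tm[OF order_refl])
  finally show "((\<lambda>s. times_imat (A s) (B s) i j) has_vector_derivative
      (b i * times_imat (A t) (B t) i j + times_imat (A t) (B t) (Suc i) j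
        - times_imat (A t) (B t) i j * b'' j
        - (if j = 0 then 0 else times_imat (A t) (B t) i (j - 1)))) (at t)"
    by (simp only: tm[OF order_refl])
qed

text \<open>Factors are appended on the right, and only the right factor is consulted one row
  further down; hence one extra row suffices for any number of factors.\<close>

lemma lax_at_L_prod:
  assumes "a \<le> b"
    and "\<And>k i. a < k \<Longrightarrow> k \<le> b \<Longrightarrow> i \<le> Suc N \<Longrightarrow> lax_at t i (\<lambda>s. L_mat p (g s) k) (\<beta> (k - 1)) (\<beta> k)"
    and "i \<le> N"
  shows "lax_at t i (\<lambda>s. L_prod p (g s) a b) (\<beta> a) (\<beta> b)"
  using assms
proof (induction b arbitrary: i rule: dec_induct)
  case base
  then show ?case by (simp add: lax_at_one)
next
  case (step n)
  have "lax_at t i (\<lambda>s. times_imat (L_prod p (g s) a n) (L_mat p (g s) (Suc n))) (\<beta> a) (\<beta> (Suc n))"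
    by (rule lax_at_times[where b' = "\<beta> n"])
      (use step hess_L_prod[OF step.hyps(1)] step.prems(1)[of "Suc n"] in \<open>auto\<close>)
  then show ?case using step.hyps by (simp add: L_prod_rec_right)
qed

text \<open>The diagonals lead from \<open>\<beta> k\<close> to \<open>\<beta> p\<close>, through U
  to \<open>\<beta> 0\<close> and back to \<open>\<beta> k\<close>. Row N needs U up to row N + 1,
  the block behind U up to N + 2, hence its factors up to N + 3.\<close>

lemma lax_at_cyc_prod:
  assumes "k \<le> p"
    and L: "\<And>k i. 0 < k \<Longrightarrow> k \<le> p \<Longrightarrow> i \<le> N + 3 \<Longrightarrow> lax_at t i (\<lambda>s. L_mat p (g s) k) (\<beta> (k - 1)) (\<beta> k)"
    and U: "\<And>i. i \<le> N + 1 \<Longrightarrow> lax_at t i (\<lambda>s. U_mat p (g s)) (\<beta> p) (\<beta> 0)"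
    and "i \<le> N"
  shows "lax_at t i (\<lambda>s. cyc_prod p (g s) k) (\<beta> k) (\<beta> k)"
  unfolding cyc_prod_def
proof (rule lax_at_times[where b' = "\<beta> p", OF _ hess_L_prod[OF assms(1)]])
  show "lax_at t i (\<lambda>s. L_prod p (g s) k p) (\<beta> k) (\<beta> p)"
    by (rule lax_at_L_prod[where N = N]) (use assms in auto)
next
  fix m assume m: "m \<le> Suc i"
  show "lax_at t m (\<lambda>s. times_imat (U_mat p (g s)) (L_prod p (g s) 0 k)) (\<beta> p) (\<beta> k)"
  proof (rule lax_at_times[where b' = "\<beta> 0", OF _ hess_U])
    fix n assume "n \<le> Suc m"
    then show "lax_at t n (\<lambda>s. L_prod p (g s) 0 k) (\<beta> 0) (\<beta> k)"
      by (intro lax_at_L_prod[where N = "N + 2"]) (use assms m in auto)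
  qed (use m U assms in auto)
qed simp

section \<open>Left null vectors of a banded Hessenberg matrix\<close>

text \<open>The unique extension of \<open>v 0, \<dots>, v (q - 1)\<close> to a left null vector of a matrix with \<open>q\<close>
  subdiagonals: column \<open>m - q\<close> determines entry \<open>m\<close>.\<close>

fun null_ext :: "nat \<Rightarrow> complex imat \<Rightarrow> (nat \<Rightarrow> complex) \<Rightarrow> nat \<Rightarrow> complex" where
  "null_ext q A v m =
     (if m < q then v m else - (\<Sum>i<m. null_ext q A v i * A i (m - q)) / A m (m - q))"

declare null_ext.simps [simp del]

lemma null_ext_init: "m < q \<Longrightarrow> null_ext q A v m = v m"
  by (simp add: null_ext.simps)

lemma null_ext_rec:
  "m \<ge> q \<Longrightarrow> null_ext q A v m = - (\<Sum>i<m. null_ext q A v i * A i (m - q)) / A m (m - q)"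
  by (simp add: null_ext.simps)

lemma null_ext_null:
  assumes "A (j + q) j \<noteq> 0"
  shows "(\<Sum>i\<le>j + q. null_ext q A v i * A i j) = 0"
  using assms null_ext_rec[of q "j + q" A v] by (simp add: lessThan_Suc_atMost[symmetric])

lemma null_ext_unique:
  assumes "\<And>j. j + q \<le> m \<Longrightarrow> (\<Sum>i\<le>j + q. w i * A i j) = 0"
    and "\<And>j. j + q \<le> m \<Longrightarrow> A (j + q) j \<noteq> 0"
    and "n \<le> m"
  shows "null_ext q A w n = w n"
  using assms(3)
proof (induction n rule: less_induct)
  case (less n)
  show ?case
  proof (cases "n < q")
    case True
    then show ?thesis by (rule null_ext_init)
  next
    case False
    then obtain j where n: "n = j + q" by (metis add.commute le_Suc_ex not_less)
    have "(\<Sum>i<n. null_ext q A w i * A i j) = (\<Sum>i<n. w i * A i j)"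
      using less by (intro sum.cong) auto
    also have "\<dots> = - w n * A n j"
      using assms(1)[of j] less.prems n
      by (simp add: lessThan_Suc_atMost[symmetric] add_eq_0_iff)
    finally show ?thesis
      using assms(2)[of j] less.prems by (subst null_ext_rec) (auto simp: n)
  qed
qed

lemma null_ext_sum:
  assumes "\<And>i. i < q \<Longrightarrow> w i = (\<Sum>k\<in>K. c k * v k i)"
  shows "null_ext q A w m = (\<Sum>k\<in>K. c k * null_ext q A (v k) m)"
proof (induction m rule: less_induct)
  case (less m)
  show ?case
  proof (cases "m < q")
    case True
    then show ?thesis using assms by (simp add: null_ext_init)
  next
    case False
    have "(\<Sum>i<m. null_ext q A w i * A i (m - q))
        = (\<Sum>i<m. \<Sum>k\<in>K. c k * (null_ext q A (v k) i * A i (m - q)))"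
      using less by (intro sum.cong) (auto simp: sum_distrib_right mult.assoc)
    also have "\<dots> = (\<Sum>k\<in>K. c k * (\<Sum>i<m. null_ext q A (v k) i * A i (m - q)))"
      by (subst sum.swap) (simp add: sum_distrib_left)
    finally have "null_ext q A w m
        = - (\<Sum>k\<in>K. c k * (\<Sum>i<m. null_ext q A (v k) i * A i (m - q))) / A m (m - q)"
      using False by (subst null_ext_rec) simp_all
    also have "\<dots> = (\<Sum>k\<in>K. c k * (- (\<Sum>i<m. null_ext q A (v k) i * A i (m - q)) / A m (m - q)))"
      by (simp add: sum_negf sum_divide_distrib[symmetric])
    also have "\<dots> = (\<Sum>k\<in>K. c k * null_ext q A (v k) m)"
      using False by (intro sum.cong refl, subst (2) null_ext_rec) simp_all
    finally show ?thesis .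
  qed
qed

lemma left_solve:
  assumes "Determinant.det (leading A n) \<noteq> 0"
  shows "\<exists>w. \<forall>j<n. (\<Sum>i<n. w i * A i j) = r j"
proof -
  have car: "leading A n \<in> carrier_mat n n" by (simp add: leading_def)
  from det_non_zero_imp_unit[OF this assms, unfolded Units_def, of "()"]
  obtain B where B: "B \<in> carrier_mat n n" and BA: "B * leading A n = 1\<^sub>m n"
    by (auto simp: ring_mat_def)
  define w where "w i = (\<Sum>k<n. r k * B $$ (k, i))" for i
  have "(\<Sum>i<n. w i * A i j) = r j" if j: "j < n" for j
  proof -
    have "(\<Sum>i<n. B $$ (k, i) * A i j) = (if k = j then 1 else 0)" if "k < n" for k
    proof -
      have "(B * leading A n) $$ (k, j) = (\<Sum>i<n. B $$ (k, i) * A i j)"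
        using that j B car
        by (auto simp: scalar_prod_def leading_def atLeast0LessThan intro!: sum.cong)
      then show ?thesis using BA that j by simp
    qed
    then have "(\<Sum>k<n. r k * (\<Sum>i<n. B $$ (k, i) * A i j)) = (\<Sum>k<n. if k = j then r k else 0)"
      by (intro sum.cong) auto
    also have "\<dots> = r j" using j by simp
    finally have "(\<Sum>k<n. r k * (\<Sum>i<n. B $$ (k, i) * A i j)) = r j" .
    moreover have "(\<Sum>i<n. w i * A i j) = (\<Sum>i<n. \<Sum>k<n. r k * (B $$ (k, i) * A i j))"
      by (simp only: w_def sum_distrib_right mult.assoc)
    moreover have "\<dots> = (\<Sum>k<n. r k * (\<Sum>i<n. B $$ (k, i) * A i j))"
      unfolding sum_distrib_left by (rule sum.swap)
    ultimately show ?thesis by simp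
  qed
  then show ?thesis by blast
qed

text \<open>For m \<ge> q, the columns 0, ..., m - q constrain the entries up to m. As the leading
  block of size n = m + 1 - q is invertible, a vector supported on the first n positions and on m,
  with value 1 at m, satisfies these constraints. Its initial values are a combination of the
  \<open>v k\<close>, which form a basis by triangularity, so some extension is nonzero at
  m.\<close>

lemma null_ext_nonzero:
  assumes q: "q \<ge> 1" and A: "hess 1 q A"
    and low: "\<And>j. j + q \<le> m \<Longrightarrow> A (j + q) j \<noteq> 0"
    and det: "\<And>n. n \<le> m \<Longrightarrow> Determinant.det (leading A n) \<noteq> 0"
    and tri: "\<And>k i. i < k \<Longrightarrow> v k i = 0" "\<And>k. v k k \<noteq> 0"
  shows "\<exists>k<q. null_ext q A (v k) m \<noteq> 0"
proof (cases "m < q")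
  case True
  then show ?thesis using tri(2)[of m] by (auto simp: null_ext_init)
next
  case False
  define n where "n = m + 1 - q"
  have n: "n \<le> m" "m = n - 1 + q" "n \<ge> 1" using q False by (auto simp: n_def)
  obtain w0 where w0: "\<And>j. j < n \<Longrightarrow> (\<Sum>i<n. w0 i * A i j) = - A m j"
    using left_solve[OF det[OF n(1)], of "\<lambda>j. - A m j"] by auto
  define w where "w i = (if i < n then w0 i else if i = m then 1 else 0)" for i
  have "(\<Sum>i\<le>j + q. w i * A i j) = 0" if j: "j + q \<le> m" for j
  proof -
    have "(\<Sum>i\<le>j + q. w i * A i j) = (\<Sum>i\<le>m. w i * A i j)"
      using j by (intro sum.mono_neutral_left) (auto simp: hess_zero[OF A])
    also have "\<dots> = (\<Sum>i<n. w i * A i j) + w m * A m j"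
    proof -
      have "(\<Sum>i\<le>m. w i * A i j) = (\<Sum>i<m. w i * A i j) + w m * A m j"
        by (simp add: lessThan_Suc_atMost[symmetric])
      moreover have "(\<Sum>i<m. w i * A i j) = (\<Sum>i<n. w i * A i j)"
        using n by (intro sum.mono_neutral_right) (auto simp: w_def)
      ultimately show ?thesis by simp
    qed
    also have "(\<Sum>i<n. w i * A i j) = - A m j"
      using w0[of j] j n by (simp add: w_def)
    also have "w m = 1" using n(1) by (simp add: w_def)
    finally show ?thesis by simp
  qed
  then have w: "null_ext q A w m = 1"
    using null_ext_unique[of q m w A m] low n(1) by (simp add: w_def)
  define e :: "nat \<Rightarrow> nat \<Rightarrow> complex" where "e k i = (if i = k then 1 else 0)" for k i
  have expand: "null_ext q A u m = (\<Sum>k<q. u k * null_ext q A (e k) m)" for u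
    by (rule null_ext_sum) (simp add: e_def if_distrib cong: if_cong)
  show ?thesis
  proof (rule ccontr)
    assume "\<not> (\<exists>k<q. null_ext q A (v k) m \<noteq> 0)"
    then have zero: "null_ext q A (v k) m = 0" if "k < q" for k using that by blast
    have "null_ext q A (e k) m = 0" if "k < q" for k
      using that
    proof (induction "q - k" arbitrary: k rule: less_induct)
      case less
      have "0 = (\<Sum>i<q. v k i * null_ext q A (e i) m)"
        using expand[of "v k"] zero[OF less.prems] by simp
      also have "\<dots> = (\<Sum>i\<in>{k}. v k i * null_ext q A (e i) m)"
      proof (rule sum.mono_neutral_right)
        show "\<forall>i\<in>{..<q} - {k}. v k i * null_ext q A (e i) m = 0"
        proof
          fix i assume i: "i \<in> {..<q} - {k}"
          show "v k i * null_ext q A (e i) m = 0"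
          proof (cases "i < k")
            case True
            then show ?thesis using tri(1) by simp
          next
            case False
            then have "null_ext q A (e i) m = 0" using i less.prems by (intro less.hyps) auto
            then show ?thesis by simp
          qed
        qed
      qed (use less.prems in auto)
      finally show ?case using tri(2) by simp
    qed
    then have "null_ext q A w m = 0" by (subst expand) simp
    with w show False by simp
  qed
qed

section \<open>Generic linear combinations\<close>

text \<open>Common zeros of \<open>f m\<close> and \<open>g m\<close> are bad for every c and stay
  in the conclusion; where only \<open>g m\<close> vanishes, no c is bad. So the curve matters only
  over the times with \<open>g m t\<close> nonzero.\<close>

lemma generic_avoid:
  fixes f g :: "nat \<Rightarrow> real \<Rightarrow> complex"
  assumes T: "\<And>m. open (T m)"
    and f: "\<And>m t. t \<in> T m \<Longrightarrow> f m differentiable (at t)"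
    and g: "\<And>m t. t \<in> T m \<Longrightarrow> g m differentiable (at t)"
  shows "\<exists>c. \<forall>m. \<forall>t\<in>T m. f m t + c * g m t = 0 \<longrightarrow> f m t = 0 \<and> g m t = 0"
proof -
  define S where "S m = {t \<in> T m. g m t \<noteq> 0}" for m
  have "negligible ((\<lambda>t. - f m t / g m t) ` S m)" for m
  proof (rule negligible_differentiable_image_lowdim)
    show "(\<lambda>t. - f m t / g m t) differentiable_on S m"
      unfolding differentiable_on_def
    proof
      fix t assume t: "t \<in> S m"
      have "(\<lambda>t. - f m t / g m t) differentiable (at t)"
        using t f g by (intro differentiable_divide differentiable_minus) (auto simp: S_def)
      then show "(\<lambda>t. - f m t / g m t) differentiable (at t within S m)"
        by (rule differentiable_at_withinI)
    qed
  qed simp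
  then have "negligible (\<Union>m. (\<lambda>t. - f m t / g m t) ` S m)"
    by (rule negligible_Union_nat)
  then obtain c where c: "c \<notin> (\<Union>m. (\<lambda>t. - f m t / g m t) ` S m)"
    using non_negligible_UNIV by (metis UNIV_I UNIV_eq_I)
  have "f m t = 0 \<and> g m t = 0" if t: "t \<in> T m" and z: "f m t + c * g m t = 0" for m t
  proof (cases "g m t = 0")
    case True
    then show ?thesis using z by simp
  next
    case False
    then have "c = - f m t / g m t" using z by (simp add: field_simps add_eq_0_iff2)
    then show ?thesis using c t False by (auto simp: S_def)
  qed
  then show ?thesis by blast
qed

text \<open>The combination of the first q functions plays the role of f in
  \<open>generic_avoid\<close>, the next function that of g.\<close>

lemma generic_combination:
  fixes F :: "nat \<Rightarrow> nat \<Rightarrow> real \<Rightarrow> complex"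
  assumes T: "\<And>m. open (T m)"
    and F: "\<And>k m t. t \<in> T m \<Longrightarrow> F k m differentiable (at t)"
  shows "\<exists>c. \<forall>m. \<forall>t\<in>T m. (\<Sum>k<q. c k * F k m t) = 0 \<longrightarrow> (\<forall>k<q. F k m t = 0)"
proof (induction q)
  case 0
  then show ?case by simp
next
  case (Suc q)
  then obtain c where c: "\<And>m t. t \<in> T m \<Longrightarrow> (\<Sum>k<q. c k * F k m t) = 0 \<Longrightarrow> \<forall>k<q. F k m t = 0"
    by blast
  have "(\<lambda>t. \<Sum>k<q. c k * F k m t) differentiable (at t)" if "t \<in> T m" for m t
    using F[OF that] by (intro differentiable_sum differentiable_mult) auto
  from generic_avoid[of T "\<lambda>m t. \<Sum>k<q. c k * F k m t" "F q", OF T this F]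
  obtain d where d: "\<And>m t. t \<in> T m \<Longrightarrow> (\<Sum>k<q. c k * F k m t) + d * F q m t = 0 \<Longrightarrow>
      (\<Sum>k<q. c k * F k m t) = 0 \<and> F q m t = 0"
    by blast
  show ?case
  proof (intro exI[of _ "c(q := d)"] allI ballI impI)
    fix m t k assume t: "t \<in> T m" and z: "(\<Sum>k<Suc q. (c(q := d)) k * F k m t) = 0" and k: "k < Suc q"
    have "(\<Sum>k<q. c k * F k m t) + d * F q m t = 0" using z by simp
    from d[OF t this] c[OF t] k show "F k m t = 0" by (auto simp: less_Suc_eq)
  qed
qed

section \<open>Triangular linear differential equations\<close>

text \<open>S may be unbounded, so it is described by endpoints in the extended reals.\<close>

lemma antiderivative_open_interval:
  fixes f :: "real \<Rightarrow> complex"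
  assumes S: "open_interval S" and f: "continuous_on S f"
  shows "\<exists>F. \<forall>t\<in>S. (F has_vector_derivative f t) (at t)"
proof (cases "S = {}")
  case True
  then show ?thesis by auto
next
  case False
  have "open S" "is_interval S" using S by (auto simp: open_interval_def)
  define a b where "a = Inf (ereal ` S)" and "b = Sup (ereal ` S)"
  have ab: "a < ereal t \<and> ereal t < b" if t: "t \<in> S" for t
  proof -
    obtain d where d: "d > 0" "ball t d \<subseteq> S"
      using \<open>open S\<close> t by (auto simp: open_contains_ball)
    have "t - d / 2 \<in> S" "t + d / 2 \<in> S"
      using d by (auto intro!: subsetD[OF d(2)] simp: dist_real_def)
    then have "a \<le> ereal (t - d / 2)" "ereal (t + d / 2) \<le> b"
      by (auto simp: a_def b_def intro: Inf_lower Sup_upper)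
    moreover have "ereal (t - d / 2) < ereal t" "ereal t < ereal (t + d / 2)" using d by auto
    ultimately show ?thesis by (metis le_less_trans less_le_trans)
  qed
  have S_eq: "t \<in> S" if at: "a < ereal t" and tb: "ereal t < b" for t
  proof -
    obtain x where "x \<in> S" "x < t"
      using at unfolding a_def Inf_less_iff by auto
    moreover obtain y where "y \<in> S" "t < y"
      using tb unfolding b_def less_Sup_iff by auto
    ultimately have "x \<in> S" "x < t" "y \<in> S" "t < y" by auto
    then show ?thesis
      using \<open>is_interval S\<close> mem_is_interval_1_I[of S x y t] by auto
  qed
  have "a < b" using False ab by (metis less_trans ex_in_conv)
  moreover have "isCont f t" if "a < ereal t" "ereal t < b" for t
    using continuous_on_eq_continuous_at[OF \<open>open S\<close>] f S_eq[OF that] by blast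
  ultimately obtain F where "\<forall>x. a < ereal x \<longrightarrow> ereal x < b \<longrightarrow> (F has_vector_derivative f x) (at x)"
    using einterval_antiderivative[of a b f] by blast
  then show ?thesis using ab by blast
qed

text \<open>Integrating factor: with B' = b, the product of exp B and z must be an antiderivative of
  - exp B h.\<close>

lemma linear_ode_solution:
  fixes b h :: "real \<Rightarrow> complex"
  assumes S: "open_interval S" and b: "continuous_on S b" and h: "continuous_on S h"
  shows "\<exists>z. (\<forall>t\<in>S. (z has_vector_derivative - (b t * z t + h t)) (at t)) \<and>
    (h = (\<lambda>t. 0) \<longrightarrow> (\<forall>t. z t \<noteq> 0))"
proof -
  obtain B where B: "\<And>t. t \<in> S \<Longrightarrow> (B has_vector_derivative b t) (at t)"
    using antiderivative_open_interval[OF S b] by blast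
  have exp_der: "((\<lambda>t. exp (e * B t)) has_vector_derivative exp (e * B t) * (e * b t)) (at t)"
    if "t \<in> S" for t e
    using field_vector_diff_chain_at[OF has_vector_derivative_mult_right[OF B[OF that]] DERIV_exp, of e]
    by (simp add: o_def mult_ac)
  have "continuous_on S (\<lambda>t. - (exp (1 * B t) * h t))"
    by (intro continuous_on_minus continuous_on_mult h continuous_at_imp_continuous_on)
      (use has_vector_derivative_continuous[OF exp_der[of _ 1]] in auto)
  from antiderivative_open_interval[OF S this]
  obtain G where G: "\<And>t. t \<in> S \<Longrightarrow> (G has_vector_derivative - (exp (1 * B t) * h t)) (at t)"
    by blast
  \<comment> \<open>For h = 0 the constant 1 is taken, which makes z a pure exponential; an
    arbitrary antiderivative could vanish.\<close>
  define G' where "G' = (if h = (\<lambda>t. 0) then (\<lambda>t. 1) else G)"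
  have G': "(G' has_vector_derivative - (exp (1 * B t) * h t)) (at t)" if "t \<in> S" for t
    using G[OF that] by (auto simp: G'_def)
  show ?thesis
  proof (intro exI[of _ "\<lambda>t. exp (- 1 * B t) * G' t"] conjI ballI impI allI)
    fix t assume t: "t \<in> S"
    have "((\<lambda>t. exp (- 1 * B t) * G' t) has_vector_derivative
        exp (- 1 * B t) * - (exp (1 * B t) * h t) + exp (- 1 * B t) * (- 1 * b t) * G' t) (at t)"
      by (rule has_vector_derivative_mult[OF exp_der[OF t] G'[OF t]])
    also have "exp (- 1 * B t) * - (exp (1 * B t) * h t) + exp (- 1 * B t) * (- 1 * b t) * G' t
        = - (b t * (exp (- 1 * B t) * G' t) + (exp (- 1 * B t) * exp (1 * B t)) * h t)"
      by (simp add: algebra_simps)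
    also have "exp (- 1 * B t) * exp (1 * B t) = 1"
      by (simp add: exp_minus)
    finally show "((\<lambda>t. exp (- 1 * B t) * G' t) has_vector_derivative
        - (b t * (exp (- 1 * B t) * G' t) + h t)) (at t)" by simp
  next
    show "exp (- 1 * B t) * G' t \<noteq> 0" if "h = (\<lambda>t. 0)" for t
      using that by (simp add: G'_def)
  qed
qed

text \<open>Each component is coupled only to its predecessor, so the components are solved one
  after the other. Those below k are 0, hence component k solves a homogeneous equation and has no
  zeros. Over all k this yields the triangular initial data for
  \<open>null_ext_nonzero\<close>.\<close>

lemma triangular_ode_solution:
  fixes b :: "real \<Rightarrow> nat \<Rightarrow> complex"
  assumes T: "\<And>m. open_interval (T m)" and dec: "\<And>m. T (Suc m) \<subseteq> T m"
    and b: "\<And>m. continuous_on (T m) (\<lambda>t. b t m)"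
  shows "\<exists>z. (\<forall>i. \<forall>t\<in>T i. (z i has_vector_derivative
      - (b t i * z i t + (if i = 0 then 0 else z (i - 1) t))) (at t)) \<and>
    (\<forall>i<k. \<forall>t. z i t = 0) \<and> (\<forall>t. z k t \<noteq> 0)"
proof -
  \<comment> \<open>Continuity belongs to the invariant because each component is the inhomogeneity
    of the next equation.\<close>
  define P :: "nat \<Rightarrow> (real \<Rightarrow> complex) \<Rightarrow> bool" where
    "P i f \<longleftrightarrow> (i < k \<longrightarrow> f = (\<lambda>t. 0)) \<and> (i = k \<longrightarrow> (\<forall>t. f t \<noteq> 0)) \<and> continuous_on (T i) f \<and>
      (i = 0 \<longrightarrow> (\<forall>t\<in>T i. (f has_vector_derivative - (b t i * f t)) (at t)))" for i f
  define Q :: "nat \<Rightarrow> (real \<Rightarrow> complex) \<Rightarrow> (real \<Rightarrow> complex) \<Rightarrow> bool" where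
    "Q i g f \<longleftrightarrow> (\<forall>t\<in>T (Suc i). (f has_vector_derivative - (b t (Suc i) * f t + g t)) (at t))" for i g f
  have step: "\<exists>f. (i < k \<longrightarrow> f = (\<lambda>t. 0)) \<and> (i = k \<longrightarrow> (\<forall>t. f t \<noteq> 0)) \<and> continuous_on (T i) f \<and>
      (\<forall>t\<in>T i. (f has_vector_derivative - (b t i * f t + h t)) (at t))"
    if h: "continuous_on (T i) h" "i \<le> k \<Longrightarrow> h = (\<lambda>t. 0)" for i h
  proof (cases "i < k")
    case True
    then show ?thesis using h by (intro exI[of _ "\<lambda>t. 0"]) auto
  next
    case False
    obtain f where f: "\<forall>t\<in>T i. (f has_vector_derivative - (b t i * f t + h t)) (at t)"
        "h = (\<lambda>t. 0) \<longrightarrow> (\<forall>t. f t \<noteq> 0)"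
      using linear_ode_solution[OF T b h(1)] by blast
    moreover have "continuous_on (T i) f"
      using f(1) by (intro continuous_at_imp_continuous_on) (auto dest: has_vector_derivative_continuous)
    ultimately show ?thesis using False h(2) by blast
  qed
  have "\<exists>f. \<forall>n. P n (f n) \<and> Q n (f n) (f (Suc n))"
  proof (rule dependent_nat_choice)
    show "\<exists>x. P 0 x"
      using step[of 0 "\<lambda>t. 0"] by (auto simp: P_def)
  next
    fix g n assume "P n g"
    then show "\<exists>f. P (Suc n) f \<and> Q n g f"
      using step[of "Suc n" g] continuous_on_subset[OF _ dec]
      by (auto simp: P_def Q_def)
  qed
  then obtain f where f: "\<And>n. P n (f n)" "\<And>n. Q n (f n) (f (Suc n))" by blast
  show ?thesis
  proof (intro exI[of _ f] conjI allI impI ballI)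
    fix i t assume "t \<in> T i"
    then show "(f i has_vector_derivative - (b t i * f i t + (if i = 0 then 0 else f (i - 1) t))) (at t)"
      using f(1)[of 0] f(2)[of "i - 1"] by (cases i) (auto simp: P_def Q_def)
  next
    show "f i t = 0" if "i < k" for i t using f(1)[of i] that by (simp add: P_def)
    show "f k t \<noteq> 0" for t using f(1)[of k] by (simp add: P_def)
  qed
qed

section \<open>Removing one subdiagonal\<close>

lemma has_vector_derivative_quotient:
  fixes f g :: "real \<Rightarrow> complex"
  assumes "(f has_vector_derivative f') (at t)" "(g has_vector_derivative g') (at t)" "g t \<noteq> 0"
  shows "((\<lambda>s. f s / g s) has_vector_derivative (f' * g t - f t * g') / (g t * g t)) (at t)"
proof -
  have "((\<lambda>s. f s / g s) has_derivative
      (\<lambda>h. ((h *\<^sub>R f') * g t - f t * (h *\<^sub>R g')) / (g t * g t))) (at t)"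
    using assms unfolding has_vector_derivative_def by (intro has_derivative_divide') auto
  then show ?thesis
    unfolding has_vector_derivative_def by (simp add: scaleR_conv_of_real algebra_simps)
qed

text \<open>Component i of y' = - y (S + b). Together with a Lax equation for X it gives (y X)' = -
  (y X) (S + b'), so that y X = 0 is compatible with the flow.\<close>

definition adjoint_at :: "real \<Rightarrow> nat \<Rightarrow> (nat \<Rightarrow> real \<Rightarrow> complex) \<Rightarrow> (nat \<Rightarrow> complex) \<Rightarrow> bool" where
  "adjoint_at t i y b \<longleftrightarrow>
     (y i has_vector_derivative - (b i * y i t + (if i = 0 then 0 else y (i - 1) t))) (at t)"

text \<open>The identity (y X)' = - (y X) (S + b') cut after row m: the shift terms telescope to a
  boundary term with row m + 1 of X.\<close>

lemma partial_product_derivative: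
  assumes y: "\<And>i. i \<le> m \<Longrightarrow> adjoint_at t i y b"
    and X: "\<And>i. i \<le> m \<Longrightarrow> lax_at t i X b b'"
  shows "((\<lambda>s. \<Sum>i\<le>m. y i s * X s i j) has_vector_derivative
    y m t * X t (Suc m) j - b' j * (\<Sum>i\<le>m. y i t * X t i j)
      - (if j = 0 then 0 else \<Sum>i\<le>m. y i t * X t i (j - 1))) (at t)"
proof -
  let ?d = "if j = 0 then 0 else 1 :: complex"
  have "((\<lambda>s. \<Sum>i\<le>m. y i s * X s i j) has_vector_derivative
    (\<Sum>i\<le>m. y i t * (b i * X t i j + X t (Suc i) j - X t i j * b' j - (if j = 0 then 0 else X t i (j - 1)))
      + - (b i * y i t + (if i = 0 then 0 else y (i - 1) t)) * X t i j)) (at t)"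
    by (intro has_vector_derivative_sum has_vector_derivative_mult)
      (use X y in \<open>auto simp: lax_at_def adjoint_at_def\<close>)
  also have "(\<Sum>i\<le>m. y i t * (b i * X t i j + X t (Suc i) j - X t i j * b' j - (if j = 0 then 0 else X t i (j - 1)))
      + - (b i * y i t + (if i = 0 then 0 else y (i - 1) t)) * X t i j)
    = (\<Sum>i\<le>m. (y i t * X t (Suc i) j - (if i = 0 then 0 else y (i - 1) t * X t i j))
        - b' j * (y i t * X t i j) - ?d * (y i t * X t i (j - 1)))"
    by (rule sum.cong) (auto simp: algebra_simps)
  also have "\<dots> = (\<Sum>i\<le>m. y i t * X t (Suc i) j - (if i = 0 then 0 else y (i - 1) t * X t i j))
        - b' j * (\<Sum>i\<le>m. y i t * X t i j) - ?d * (\<Sum>i\<le>m. y i t * X t i (j - 1))"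
    by (simp only: sum_subtractf sum_distrib_left)
  also have "(\<Sum>i\<le>m. y i t * X t (Suc i) j - (if i = 0 then 0 else y (i - 1) t * X t i j))
      = y m t * X t (Suc m) j"
    by (induction m) auto
  also have "?d * (\<Sum>i\<le>m. y i t * X t i (j - 1))
      = (if j = 0 then 0 else \<Sum>i\<le>m. y i t * X t i (j - 1))"
    by simp
  finally show ?thesis .
qed

text \<open>The state between two splittings, with q subdiagonals left. The band shape of X holds
  for all t, the other properties of row m only on \<open>T m\<close>.\<close>

locale lax_hessenberg =
  fixes q :: nat and X :: "real \<Rightarrow> complex imat" and b b' :: "real \<Rightarrow> nat \<Rightarrow> complex"
    and T :: "nat \<Rightarrow> real set"
  assumes T_interval: "open_interval (T m)"
    and T_Suc: "T (Suc m) \<subseteq> T m"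
    and X_hess: "hess 1 q (X t)"
    and X_low: "t \<in> T (j + q) \<Longrightarrow> X t (j + q) j \<noteq> 0"
    and X_det: "t \<in> T n \<Longrightarrow> Determinant.det (leading (X t) n) \<noteq> 0"
    and X_lax: "t \<in> T i \<Longrightarrow> lax_at t i X (b t) (b' t)"
    and b_cont: "continuous_on (T m) (\<lambda>t. b t m)"
begin

lemma T_antimono: "m \<le> n \<Longrightarrow> T n \<subseteq> T m"
  using T_Suc by (rule lift_Suc_antimono_le)

lemma T_open: "open (T m)"
  using T_interval by (simp add: open_interval_def)

lemma T_le: "t \<in> T n \<Longrightarrow> m \<le> n \<Longrightarrow> t \<in> T m"
  using T_antimono by blast

text \<open>The first q components solve the equation by assumption. Any later one is a truncated
  column sum divided by an entry of the lowest subdiagonal, and both have known derivatives.\<close>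

lemma null_ext_adjoint:
  assumes q: "q \<ge> 1"
    and z: "\<And>i t. t \<in> T i \<Longrightarrow> adjoint_at t i z (b t)"
    and t: "t \<in> T m"
  shows "adjoint_at t m (\<lambda>i s. null_ext q (X s) (\<lambda>k. z k s) i) (b t)"
  using t
proof (induction m rule: less_induct)
  case (less m)
  define y where "y i s = null_ext q (X s) (\<lambda>k. z k s) i" for i s
  have y_init: "y i = z i" if "i < q" for i
    using that by (auto simp: y_def null_ext_init)
  have IH: "adjoint_at t i y (b t)" if "i < m" for i
    using less.IH[OF that T_le[OF less.prems]] that by (simp add: y_def[abs_def])
  have "adjoint_at t m y (b t)"
  proof (cases "m < q")
    case True
    then show ?thesis
      using z[OF less.prems] by (cases m) (auto simp: adjoint_at_def y_init)
  next
    case False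
    then obtain j where mj: "m = j + q" by (metis add.commute le_Suc_ex not_less)
    then obtain n where mn: "m = Suc n" using q by (metis Suc_le_D le_add2 le_trans One_nat_def)
    define \<sigma> where "\<sigma> k s = (\<Sum>i\<le>n. y i s * X s i k)" for k s
    have y_m: "y m s = - \<sigma> j s / X s m j" for s
    proof -
      have "y m s = - (\<Sum>i<m. y i s * X s i (m - q)) / X s m (m - q)"
        unfolding y_def using mj by (subst null_ext_rec) auto
      then show ?thesis by (simp add: \<sigma>_def mj mn[symmetric] lessThan_Suc_atMost[symmetric])
    qed
    have low: "X t m j \<noteq> 0" using X_low[of t j] less.prems mj by simp
    \<comment> \<open>Column j - 1 ends in row n, so its truncated sum is already the full null
      condition.\<close>
    have prev: "\<sigma> (j - 1) t = 0" if "j \<noteq> 0"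
    proof -
      have "n = j - 1 + q" using that mj mn by simp
      moreover have "t \<in> T (j - 1 + q)" using less.prems mj by (elim T_le) simp
      ultimately show ?thesis
        using null_ext_null[of "X t" "j - 1" q] X_low[of t "j - 1"] by (simp add: \<sigma>_def y_def)
    qed
    have "((\<lambda>s. \<sigma> j s) has_vector_derivative
        y n t * X t (Suc n) j - b' t j * \<sigma> j t - (if j = 0 then 0 else \<sigma> (j - 1) t)) (at t)"
      unfolding \<sigma>_def
      using partial_product_derivative[of n t y "b t" X "b' t" j] IH X_lax T_le[OF less.prems] mn by auto
    then have ds: "(\<sigma> j has_vector_derivative y n t * X t m j - b' t j * \<sigma> j t) (at t)"
      using prev mn by (cases "j = 0") simp_all
    \<comment> \<open>Both neighbours lie below the band, so the entry of the lowest subdiagonal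
      obeys a scalar linear equation.\<close>
    have "X t (Suc m) j = 0" "j \<noteq> 0 \<Longrightarrow> X t m (j - 1) = 0"
      using hess_zero[OF X_hess] mj by auto
    then have dX: "((\<lambda>s. X s m j) has_vector_derivative b t m * X t m j - X t m j * b' t j) (at t)"
      using X_lax[OF less.prems] unfolding lax_at_def by (cases "j = 0") (auto dest!: spec[of _ j])
    have "((\<lambda>s. - \<sigma> j s / X s m j) has_vector_derivative
        (- (y n t * X t m j - b' t j * \<sigma> j t) * X t m j - - \<sigma> j t * (b t m * X t m j - X t m j * b' t j))
          / (X t m j * X t m j)) (at t)"
      by (intro has_vector_derivative_quotient has_vector_derivative_minus ds dX low)
    also have "(- (y n t * X t m j - b' t j * \<sigma> j t) * X t m j - - \<sigma> j t * (b t m * X t m j - X t m j * b' t j))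
          / (X t m j * X t m j) = - (b t m * y m t + y n t)"
      unfolding y_m using low by (simp add: field_simps)
    finally have "((\<lambda>s. - \<sigma> j s / X s m j) has_vector_derivative - (b t m * y m t + y n t)) (at t)" .
    moreover have "y m = (\<lambda>s. - \<sigma> j s / X s m j)" using y_m by blast
    ultimately show ?thesis by (simp add: adjoint_at_def mn)
  qed
  then show ?case by (simp add: y_def[abs_def])
qed

lemma nonvanishing_null_vector:
  assumes q: "q \<ge> 1"
  shows "\<exists>y. (\<forall>m t. y m t \<noteq> 0) \<and> (\<forall>m. \<forall>t\<in>T m. adjoint_at t m y (b t)) \<and>
    (\<forall>j. \<forall>t\<in>T (j + q). (\<Sum>i\<le>j + q. y i t * X t i j) = 0)"
proof -
  have "\<forall>k. \<exists>z. (\<forall>i. \<forall>t\<in>T i. adjoint_at t i z (b t)) \<and> (\<forall>i<k. \<forall>t. z i t = 0) \<and> (\<forall>t. z k t \<noteq> 0)"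
    unfolding adjoint_at_def
    by (intro allI triangular_ode_solution T_interval T_Suc b_cont)
  then obtain z where z: "\<And>k i t. t \<in> T i \<Longrightarrow> adjoint_at t i (z k) (b t)"
      "\<And>k i t. i < k \<Longrightarrow> z k i t = 0" "\<And>k t. z k k t \<noteq> 0"
    by metis
  define F where "F k m t = null_ext q (X t) (\<lambda>i. z k i t) m" for k m t
  have F: "adjoint_at t m (F k) (b t)" if "t \<in> T m" for k m t
    using null_ext_adjoint[OF q z(1) that] by (simp add: F_def[abs_def])
  have "F k m differentiable (at t)" if "t \<in> T m" for k m t
    using F[OF that] unfolding adjoint_at_def
    by (auto simp: has_vector_derivative_def differentiable_def)
  from generic_combination[of T F q, OF T_open this]
  obtain c where c: "\<And>m t. t \<in> T m \<Longrightarrow> (\<Sum>k<q. c k * F k m t) = 0 \<Longrightarrow> \<forall>k<q. F k m t = 0"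
    by blast
  define y0 where "y0 m t = (\<Sum>k<q. c k * F k m t)" for m t
  \<comment> \<open>The default 1 off \<open>T m\<close> keeps y nonzero at all times, as needed for
    the band shape of the next matrix, which is asserted for all t.\<close>
  define y where "y m t = (if t \<in> T m then y0 m t else 1)" for m t
  have "y m t \<noteq> 0" for m t
  proof (cases "t \<in> T m")
    case True
    have "\<exists>k<q. F k m t \<noteq> 0"
      unfolding F_def
      by (rule null_ext_nonzero[OF q X_hess]) (use True T_le X_low X_det z in auto)
    then show ?thesis using c[OF True] True by (auto simp: y_def y0_def)
  qed (simp add: y_def)
  moreover have "adjoint_at t m y (b t)" if t: "t \<in> T m" for m t
  proof -
    have "(y0 m has_vector_derivative
        (\<Sum>k<q. c k * - (b t m * F k m t + (if m = 0 then 0 else F k (m - 1) t)))) (at t)"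
      unfolding y0_def using F[OF t] unfolding adjoint_at_def
      by (intro has_vector_derivative_sum has_vector_derivative_mult_right) auto
    also have "(\<Sum>k<q. c k * - (b t m * F k m t + (if m = 0 then 0 else F k (m - 1) t)))
        = - (b t m * y0 m t + (if m = 0 then 0 else y0 (m - 1) t))"
      by (simp add: y0_def sum_distrib_left sum_negf[symmetric] sum.distrib algebra_simps
          sum_subtractf)
    finally have "(y m has_vector_derivative
        - (b t m * y0 m t + (if m = 0 then 0 else y0 (m - 1) t))) (at t)"
      by (rule has_vector_derivative_transform_within_open[OF _ T_open t]) (simp add: y_def)
    then show ?thesis
      using t T_le[OF t, of "m - 1"] by (cases m) (simp_all add: adjoint_at_def y_def)
  qed
  moreover have "(\<Sum>i\<le>j + q. y i t * X t i j) = 0" if t: "t \<in> T (j + q)" for j t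
  proof -
    have "(\<Sum>i\<le>j + q. y i t * X t i j) = (\<Sum>i\<le>j + q. \<Sum>k<q. c k * (F k i t * X t i j))"
      using T_le[OF t] by (intro sum.cong) (auto simp: y_def y0_def sum_distrib_right mult.assoc)
    also have "\<dots> = (\<Sum>k<q. c k * (\<Sum>i\<le>j + q. F k i t * X t i j))"
      by (subst sum.swap) (simp add: sum_distrib_left)
    also have "\<dots> = 0"
      using null_ext_null[of "X t" j q] X_low[OF t] by (simp add: F_def)
    finally show ?thesis .
  qed
  ultimately show ?thesis by blast
qed

text \<open>The inverse of L has the entries y_i / y_m for i \<le> m. Hence row m of X1 is the
  partial sum of y X up to row m, divided by y_m, and the null condition removes the lowest
  subdiagonal. Domains move by one index because \<open>l t m\<close> contains y_(m+1).\<close>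

lemma remove_subdiagonal:
  assumes q: "q \<ge> 1"
  shows "\<exists>X1 b1 l. lax_hessenberg (q - 1) X1 b1 b' (\<lambda>m. T (Suc m)) \<and>
    (\<forall>t m. b1 t m = b t m + l t m - (if m = 0 then 0 else l t (m - 1))) \<and>
    (\<forall>m. \<forall>t\<in>T (Suc m). ((\<lambda>s. l s m) has_vector_derivative l t m * (b t (Suc m) - b1 t m)) (at t)) \<and>
    (\<forall>m. \<forall>t\<in>T m. \<forall>j. X t m j = X1 t m j + (if m = 0 then 0 else l t (m - 1) * X1 t (m - 1) j))"
proof -
  obtain y where y_nz: "\<And>m t. y m t \<noteq> 0"
    and y_adj: "\<And>m t. t \<in> T m \<Longrightarrow> adjoint_at t m y (b t)"
    and y_null: "\<And>j t. t \<in> T (j + q) \<Longrightarrow> (\<Sum>i\<le>j + q. y i t * X t i j) = 0"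
    using nonvanishing_null_vector[OF q] by blast
  define \<sigma> where "\<sigma> m j t = (\<Sum>i\<le>m. y i t * X t i j)" for m j t
  define l where "l t m = - y m t / y (Suc m) t" for t m
  define b1 where "b1 t m = b t m + l t m - (if m = 0 then 0 else l t (m - 1))" for t m
  \<comment> \<open>Below the new band the quotient is known to vanish only on \<open>T m\<close>;
    the explicit 0 gives the band shape for all t.\<close>
  define X1 where "X1 t m j = (if m < j + q then \<sigma> m j t / y m t else 0)" for t m j
  have X1: "X1 t m j = \<sigma> m j t / y m t" if t: "t \<in> T m" for t m j
  proof (cases "m < j + q")
    case False
    have "\<sigma> m j t = \<sigma> (j + q) j t"
      unfolding \<sigma>_def using False by (intro sum.mono_neutral_right) (auto simp: hess_zero[OF X_hess])
    also have "\<dots> = 0" using y_null T_le[OF t] False by (simp add: \<sigma>_def)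
    finally show ?thesis by (simp add: X1_def)
  qed (simp add: X1_def)
  have fact: "X t m j = X1 t m j + (if m = 0 then 0 else l t (m - 1) * X1 t (m - 1) j)"
    if t: "t \<in> T m" for t m j
  proof (cases m)
    case 0
    then show ?thesis using X1[OF t] y_nz by (simp add: \<sigma>_def)
  next
    case (Suc n)
    have "X1 t n j = \<sigma> n j t / y n t" using X1 T_le[OF t] Suc by simp
    then show ?thesis using X1[OF t] y_nz Suc by (simp add: \<sigma>_def l_def field_simps)
  qed
  have dl: "((\<lambda>s. l s m) has_vector_derivative l t m * (b t (Suc m) - b1 t m)) (at t)"
    if t: "t \<in> T (Suc m)" for t m
  proof -
    let ?p = "if m = 0 then 0 else y (m - 1) t"
    have "((\<lambda>s. - y m s / y (Suc m) s) has_vector_derivative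
      (- (- (b t m * y m t + ?p)) * y (Suc m) t - - y m t * (- (b t (Suc m) * y (Suc m) t + y m t)))
        / (y (Suc m) t * y (Suc m) t)) (at t)"
      using y_adj[OF t] y_adj[OF T_le[OF t], of m] y_nz unfolding adjoint_at_def
      by (intro has_vector_derivative_quotient has_vector_derivative_minus) auto
    also have "(- (- (b t m * y m t + ?p)) * y (Suc m) t - - y m t * (- (b t (Suc m) * y (Suc m) t + y m t)))
        / (y (Suc m) t * y (Suc m) t) = l t m * (b t (Suc m) - b1 t m)"
      using y_nz[of m t] y_nz[of "Suc m" t]
      by (cases m) (simp_all add: b1_def l_def field_simps)
    finally show ?thesis by (simp add: l_def)
  qed
  have "lax_hessenberg (q - 1) X1 b1 b' (\<lambda>m. T (Suc m))"
  proof
    show "open_interval (T (Suc m))" "T (Suc (Suc m)) \<subseteq> T (Suc m)" for m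
      by (rule T_interval T_Suc)+
    show "hess 1 (q - 1) (X1 t)" for t
      unfolding hess_def
    proof (intro conjI allI impI)
      fix i
      have "\<sigma> i (Suc i) t = (\<Sum>k\<in>{i}. y k t * X t k (Suc i))"
        unfolding \<sigma>_def by (rule sum.mono_neutral_right) (auto simp: hess_zero[OF X_hess])
      then show "X1 t i (i + 1) = 1"
        using hess_diag[OF X_hess, of t i] y_nz by (simp add: X1_def)
    next
      fix i j assume "i + 1 < j \<or> j + (q - 1) < i"
      then consider "i + 1 < j" | "\<not> i < j + q" using q by linarith
      then show "X1 t i j = 0"
      proof cases
        case 1
        then show ?thesis by (simp add: X1_def \<sigma>_def hess_zero[OF X_hess])
      qed (simp add: X1_def)
    qed
    show "X1 t (j + (q - 1)) j \<noteq> 0" if "t \<in> T (Suc (j + (q - 1)))" for t j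
    proof -
      have t: "t \<in> T (j + q)" using that q by simp
      have "\<sigma> (j + (q - 1)) j t + y (j + q) t * X t (j + q) j = 0"
        using y_null[OF t] q by (cases q) (simp_all add: \<sigma>_def)
      then have "\<sigma> (j + (q - 1)) j t \<noteq> 0" using X_low[OF t] y_nz[of "j + q" t] by auto
      then show ?thesis using q y_nz by (simp add: X1_def)
    qed
    show "Determinant.det (leading (X1 t) n) \<noteq> 0" if "t \<in> T (Suc n)" for t n
    proof -
      have t: "t \<in> T n" using T_le[OF that] by simp
      \<comment> \<open>The leading block of L. As L is lower triangular, leading blocks multiply,
        so the block of X1 inherits a nonzero determinant.\<close>
      define M where "M = Matrix.mat n n (\<lambda>(i, j). if i = j then 1 else if i = Suc j then l t j else 0)"
      have car: "M \<in> carrier_mat n n" "leading (X1 t) n \<in> carrier_mat n n"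
        by (simp_all add: M_def leading_def)
      have "leading (X t) n = M * leading (X1 t) n"
      proof (rule eq_matI)
        fix i j assume "i < dim_row (M * leading (X1 t) n)" "j < dim_col (M * leading (X1 t) n)"
        then have ij: "i < n" "j < n" by (simp_all add: M_def leading_def)
        have "(M * leading (X1 t) n) $$ (i, j)
            = (\<Sum>k<n. (if i = k then 1 else if i = Suc k then l t k else 0) * X1 t k j)"
          using ij by (auto simp: scalar_prod_def M_def leading_def atLeast0LessThan intro!: sum.cong)
        also have "\<dots> = (\<Sum>k\<in>{i, i - 1}. (if i = k then 1 else if i = Suc k then l t k else 0) * X1 t k j)"
          using ij by (intro sum.mono_neutral_right) auto
        also have "\<dots> = X t i j"
          using fact[OF T_le[OF t], of i j] ij by (cases i) auto
        finally show "leading (X t) n $$ (i, j) = (M * leading (X1 t) n) $$ (i, j)"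
          using ij by (simp add: leading_def)
      qed (simp_all add: M_def leading_def)
      then show ?thesis using X_det[OF t] det_mult[OF car] by auto
    qed
    show "lax_at t m X1 (b1 t) (b' t)" if t: "t \<in> T (Suc m)" for t m
      unfolding lax_at_def
    proof
      fix j
      let ?p = "if m = 0 then 0 else y (m - 1) t" and ?X' = "if j = 0 then 0 else X1 t m (j - 1)"
      have tm: "t \<in> T m" using T_le[OF t] by simp
      have s: "\<sigma> m k t = X1 t m k * y m t" for k using X1[OF tm] y_nz by simp
      have "((\<lambda>s. \<sigma> m j s) has_vector_derivative y m t * X t (Suc m) j - b' t j * \<sigma> m j t
          - (if j = 0 then 0 else \<sigma> m (j - 1) t)) (at t)"
        unfolding \<sigma>_def
        by (rule partial_product_derivative[where b = "b t"]) (use y_adj X_lax T_le[OF tm] in auto)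
      also have "(if j = 0 then 0 else \<sigma> m (j - 1) t) = ?X' * y m t"
        by (simp add: s)
      finally have ds: "((\<lambda>s. \<sigma> m j s) has_vector_derivative y m t * X t (Suc m) j
          - b' t j * \<sigma> m j t - ?X' * y m t) (at t)" .
      have "((\<lambda>s. \<sigma> m j s / y m s) has_vector_derivative
          ((y m t * X t (Suc m) j - b' t j * \<sigma> m j t - ?X' * y m t) * y m t
            - \<sigma> m j t * - (b t m * y m t + ?p)) / (y m t * y m t)) (at t)"
        using y_adj[OF tm] y_nz unfolding adjoint_at_def
        by (intro has_vector_derivative_quotient ds) auto
      also have "((y m t * X t (Suc m) j - b' t j * \<sigma> m j t - ?X' * y m t) * y m t
            - \<sigma> m j t * - (b t m * y m t + ?p)) / (y m t * y m t)
          = X t (Suc m) j - b' t j * X1 t m j - ?X' + X1 t m j * (b t m + ?p / y m t)"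
        unfolding s using y_nz[of m t] by (simp add: field_simps)
      \<comment> \<open>This substitution contributes l_m, and - y_m' / y_m = b_m - l_(m-1);
        together they form \<open>b1\<close>.\<close>
      also have "X t (Suc m) j = X1 t (Suc m) j + l t m * X1 t m j"
        using fact[OF t] by simp
      also have "?p / y m t = - (if m = 0 then 0 else l t (m - 1))"
        by (cases m) (simp_all add: l_def)
      also have "X1 t (Suc m) j + l t m * X1 t m j - b' t j * X1 t m j - ?X'
          + X1 t m j * (b t m + - (if m = 0 then 0 else l t (m - 1)))
        = b1 t m * X1 t m j + X1 t (Suc m) j - X1 t m j * b' t j - ?X'"
        by (simp add: b1_def algebra_simps)
      finally show "((\<lambda>s. X1 s m j) has_vector_derivative
          b1 t m * X1 t m j + X1 t (Suc m) j - X1 t m j * b' t j - ?X') (at t)"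
        by (rule has_vector_derivative_transform_within_open[OF _ T_open tm]) (simp add: X1)
    qed
    show "continuous_on (T (Suc m)) (\<lambda>t. b1 t m)" for m
    proof -
      have l: "continuous_on (T (Suc n)) (\<lambda>t. l t n)" for n
        using dl by (intro continuous_at_imp_continuous_on ballI has_vector_derivative_continuous)
      have "continuous_on (T (Suc m)) (\<lambda>t. if m = 0 then 0 else l t (m - 1))"
        using l[of "m - 1"] continuous_on_subset[OF _ T_Suc] by (cases m) auto
      then show ?thesis
        unfolding b1_def
        by (intro continuous_on_add continuous_on_diff l continuous_on_subset[OF b_cont T_Suc])
    qed
  qed
  then show ?thesis using dl fact b1_def by blast
qed

end

lemma (in lax_hessenberg) bidiagonal_factorization:
  "\<exists>Xs bs l. Xs 0 = X \<and> bs 0 = b \<and>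
    (\<forall>k\<le>q. lax_hessenberg (q - k) (Xs k) (bs k) b' (\<lambda>m. T (m + k))) \<and>
    (\<forall>k<q. \<forall>t m. bs (Suc k) t m
      = bs k t m + l (Suc k) t m - (if m = 0 then 0 else l (Suc k) t (m - 1))) \<and>
    (\<forall>k<q. \<forall>m. \<forall>t\<in>T (Suc m + k). ((\<lambda>s. l (Suc k) s m) has_vector_derivative
      l (Suc k) t m * (bs k t (Suc m) - bs (Suc k) t m)) (at t)) \<and>
    (\<forall>k<q. \<forall>m. \<forall>t\<in>T (m + k). \<forall>j. Xs k t m j
      = Xs (Suc k) t m j + (if m = 0 then 0 else l (Suc k) t (m - 1) * Xs (Suc k) t (m - 1) j))"
proof -
  \<comment> \<open>A triple holds the matrix, its left diagonal and the subdiagonal of the factor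
    split off last, which is arbitrary at k = 0. Past q the conditions are void, so the choice can
    always continue.\<close>
  define P :: "nat \<Rightarrow> (real \<Rightarrow> complex imat) \<times> (real \<Rightarrow> nat \<Rightarrow> complex) \<times> (real \<Rightarrow> nat \<Rightarrow> complex) \<Rightarrow> bool"
    where "P k = (\<lambda>(Y, c, _). (k = 0 \<longrightarrow> Y = X \<and> c = b) \<and>
      (k \<le> q \<longrightarrow> lax_hessenberg (q - k) Y c b' (\<lambda>m. T (m + k))))" for k
  define Q :: "nat \<Rightarrow> (real \<Rightarrow> complex imat) \<times> (real \<Rightarrow> nat \<Rightarrow> complex) \<times> (real \<Rightarrow> nat \<Rightarrow> complex)
      \<Rightarrow> (real \<Rightarrow> complex imat) \<times> (real \<Rightarrow> nat \<Rightarrow> complex) \<times> (real \<Rightarrow> nat \<Rightarrow> complex) \<Rightarrow> bool"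
    where "Q k = (\<lambda>(Y, c, _) (Y1, c1, l). k < q \<longrightarrow>
      (\<forall>t m. c1 t m = c t m + l t m - (if m = 0 then 0 else l t (m - 1))) \<and>
      (\<forall>m. \<forall>t\<in>T (Suc m + k). ((\<lambda>s. l s m) has_vector_derivative l t m * (c t (Suc m) - c1 t m)) (at t)) \<and>
      (\<forall>m. \<forall>t\<in>T (m + k). \<forall>j. Y t m j = Y1 t m j + (if m = 0 then 0 else l t (m - 1) * Y1 t (m - 1) j)))"
    for k
  have "\<exists>f. \<forall>k. P k (f k) \<and> Q k (f k) (f (Suc k))"
  proof (rule dependent_nat_choice)
    have "lax_hessenberg q X b b' T" ..
    then show "\<exists>x. P 0 x" by (auto simp: P_def)
  next
    fix x k assume x: "P k x"
    obtain Y c l0 where xeq: "x = (Y, c, l0)" by (metis prod_cases3)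
    show "\<exists>y. P (Suc k) y \<and> Q k x y"
    proof (cases "k < q")
      case True
      interpret Y: lax_hessenberg "q - k" Y c b' "\<lambda>m. T (m + k)"
        using x True by (simp add: P_def xeq)
      obtain Y1 c1 l where "lax_hessenberg (q - k - 1) Y1 c1 b' (\<lambda>m. T (Suc m + k))"
        and rel: "\<forall>t m. c1 t m = c t m + l t m - (if m = 0 then 0 else l t (m - 1))"
          "\<forall>m. \<forall>t\<in>T (Suc m + k). ((\<lambda>s. l s m) has_vector_derivative l t m * (c t (Suc m) - c1 t m)) (at t)"
          "\<forall>m. \<forall>t\<in>T (m + k). \<forall>j. Y t m j = Y1 t m j + (if m = 0 then 0 else l t (m - 1) * Y1 t (m - 1) j)"
        using Y.remove_subdiagonal True by (metis One_nat_def Suc_leI zero_less_diff)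
      then have "P (Suc k) (Y1, c1, l)" by (simp add: P_def)
      moreover have "Q k x (Y1, c1, l)" using rel by (simp add: Q_def xeq)
      ultimately show ?thesis by blast
    next
      case False
      then show ?thesis by (auto simp: P_def Q_def xeq)
    qed
  qed
  then obtain f where f: "\<And>k. P k (f k)" "\<And>k. Q k (f k) (f (Suc k))" by blast
  show ?thesis
  proof (rule exI[of _ "\<lambda>k. fst (f k)"], rule exI[of _ "\<lambda>k. fst (snd (f k))"],
      rule exI[of _ "\<lambda>k. snd (snd (f k))"], intro conjI)
    show "fst (f 0) = X" "fst (snd (f 0)) = b"
      using f(1)[of 0] by (simp_all add: P_def case_prod_beta)
    show "\<forall>k\<le>q. lax_hessenberg (q - k) (fst (f k)) (fst (snd (f k))) b' (\<lambda>m. T (m + k))"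
      using f(1) by (simp add: P_def case_prod_beta)
  qed (rule allI, rule impI, drule f(2)[unfolded Q_def case_prod_beta, THEN mp], elim conjE, assumption)+
qed

section \<open>From the factors to the solutions\<close>

text \<open>A window of p + 1 consecutive values moves by one place: one value enters, one leaves.
  The guards express that g counts as 0 at indices \<le> 0.\<close>

lemma window_sum_Suc:
  fixes g :: "nat \<Rightarrow> complex"
  shows "(\<Sum>i\<le>p. if i < Suc n then g (Suc n - i) else 0)
    = (\<Sum>i\<le>p. if i < n then g (n - i) else 0) + g (Suc n) - (if p < n then g (n - p) else 0)"
proof -
  let ?h = "\<lambda>i. if i < Suc n then g (Suc n - i) else 0"
  have "(\<Sum>i\<le>p. ?h i) + ?h (Suc p) = ?h 0 + (\<Sum>i\<le>p. ?h (Suc i))"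
    using sum.atMost_Suc[of ?h p] sum.atMost_Suc_shift[of ?h p] by presburger
  then have "(\<Sum>i\<le>p. ?h i) = (\<Sum>i\<le>p. ?h (Suc i)) + ?h 0 - ?h (Suc p)"
    by (simp only: eq_diff_eq add.commute)
  then show ?thesis by (simp only: Suc_less_eq diff_Suc_Suc diff_zero zero_less_Suc if_True)
qed

text \<open>The windows ending at n + p and at n share only g n, which cancels and leaves the
  bracket of the discrete KdV equation.\<close>

lemma window_sum_diff:
  fixes g :: "nat \<Rightarrow> complex"
  assumes "n \<ge> 1"
  shows "(\<Sum>i\<le>p. if i < n + p then g (n + p - i) else 0) - (\<Sum>i\<le>p. if i < n then g (n - i) else 0)
    = (\<Sum>i=1..p. g (n + i)) - (\<Sum>i=1..p. if i < n then g (n - i) else 0)"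
proof -
  have split: "sum h {..p} = h 0 + sum h {1..p}" for h :: "nat \<Rightarrow> complex"
    by (simp add: atMost_atLeast0 sum.atLeast_Suc_atMost)
  have "(\<Sum>i\<le>p. if i < n + p then g (n + p - i) else 0) = (\<Sum>i\<le>p. g (n + (p - i)))"
    using assms by (intro sum.cong) auto
  also have "\<dots> = (\<Sum>i\<le>p. g (n + i))"
    using sum.atLeastAtMost_rev[of "\<lambda>i. g (n + i)" 0 p] by (simp add: atMost_atLeast0)
  finally show ?thesis using assms by (simp add: split)
qed

text \<open>\<open>\<beta> k t\<close> is the diagonal of \<open>J\<^sup>(\<^sup>k\<^sup>)\<close> at time \<open>t\<close>.\<close>

locale bidiagonal_flow =
  fixes p :: nat and C :: complex and \<gamma> :: "real \<Rightarrow> nat \<Rightarrow> complex"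
    and \<beta> :: "nat \<Rightarrow> real \<Rightarrow> nat \<Rightarrow> complex" and W :: "nat \<Rightarrow> real set"
  assumes p: "p \<ge> 1"
    and W_interval: "open_interval (W n)"
    and W_antimono: "m \<le> n \<Longrightarrow> W n \<subseteq> W m"
    and W_nonempty: "W n \<noteq> {}"
    and beta_Suc: "k < p \<Longrightarrow> \<beta> (Suc k) t m = \<beta> k t m + \<gamma> t (m * (p + 1) + Suc k + 1)
      - (if m = 0 then 0 else \<gamma> t ((m - 1) * (p + 1) + Suc k + 1))"
    and gamma_L: "k < p \<Longrightarrow> t \<in> W (m + p + 1) \<Longrightarrow>
      ((\<lambda>s. \<gamma> s (m * (p + 1) + Suc k + 1)) has_vector_derivative
        \<gamma> t (m * (p + 1) + Suc k + 1) * (\<beta> k t (Suc m) - \<beta> (Suc k) t m)) (at t)"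
    and gamma_U: "t \<in> W (m + p + 1) \<Longrightarrow>
      ((\<lambda>s. \<gamma> s (m * (p + 1) + 1)) has_vector_derivative
        \<gamma> t (m * (p + 1) + 1) * (\<beta> p t m - \<beta> 0 t m)) (at t)"
    and beta_wrap: "t \<in> W (m + p + 1) \<Longrightarrow>
      \<beta> 0 t (Suc m) = \<beta> p t m + \<gamma> t (Suc m * (p + 1) + 1) - \<gamma> t (m * (p + 1) + 1)"
    and beta_0: "t \<in> W (p + 1) \<Longrightarrow> \<beta> 0 t 0 = C + \<gamma> t 1"
    and diag_0: "t \<in> W (m + p + 1) \<Longrightarrow> \<beta> 0 t m = C + cyc_prod p (\<gamma> t) 0 m m"
begin

lemma W_le: "t \<in> W n \<Longrightarrow> m \<le> n \<Longrightarrow> t \<in> W m"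
  using W_antimono by blast

text \<open>On the subdiagonal this is \<open>gamma_L\<close>. The diagonal is constant, so the
  right side must vanish there, which is \<open>beta_Suc\<close>.\<close>

lemma lax_L:
  assumes "0 < k" "k \<le> p" "t \<in> W (i + p + 1)"
  shows "lax_at t i (\<lambda>s. L_mat p (\<gamma> s) k) (\<beta> (k - 1) t) (\<beta> k t)"
  unfolding lax_at_def
proof
  fix j
  obtain k' where k: "k = Suc k'" "k' < p" using assms by (cases k) auto
  note bS = beta_Suc[OF k(2), of t]
  consider "i = Suc j" | "i = j" | "j = Suc i" | "i > Suc j" | "j > Suc i" by linarith
  then show "((\<lambda>s. L_mat p (\<gamma> s) k i j) has_vector_derivative
     \<beta> (k - 1) t i * L_mat p (\<gamma> t) k i j + L_mat p (\<gamma> t) k (Suc i) j - L_mat p (\<gamma> t) k i j * \<beta> k t j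
       - (if j = 0 then 0 else L_mat p (\<gamma> t) k i (j - 1))) (at t)"
  proof cases
    case 1
    have "t \<in> W (j + p + 1)" using assms(3) 1 by (elim W_le) simp
    from gamma_L[OF k(2) this] show ?thesis
      using 1 by (cases j) (simp_all add: L_mat_def k algebra_simps)
  next
    case 2
    then show ?thesis
      using bS[of j] by (cases j) (simp_all add: L_mat_def k)
  qed (auto simp: L_mat_def)
qed

text \<open>The diagonal is \<open>gamma_U\<close>; the constant superdiagonal requires
  \<open>beta_wrap\<close>.\<close>

lemma lax_U:
  assumes "t \<in> W (i + p + 1)"
  shows "lax_at t i (\<lambda>s. U_mat p (\<gamma> s)) (\<beta> p t) (\<beta> 0 t)"
  unfolding lax_at_def
proof
  fix j
  consider "i = j" | "j = Suc i" | "i > j" | "j = Suc (Suc i)" | "j > Suc (Suc i)" by linarith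
  then show "((\<lambda>s. U_mat p (\<gamma> s) i j) has_vector_derivative
     \<beta> p t i * U_mat p (\<gamma> t) i j + U_mat p (\<gamma> t) (Suc i) j - U_mat p (\<gamma> t) i j * \<beta> 0 t j
       - (if j = 0 then 0 else U_mat p (\<gamma> t) i (j - 1))) (at t)"
  proof cases
    case 1
    then show ?thesis
      using gamma_U[OF assms] by (auto simp: U_mat_def algebra_simps)
  next
    case 2
    then show ?thesis using beta_wrap[OF assms] by (simp add: U_mat_def)
  qed (auto simp: U_mat_def)
qed

text \<open>The 4 consists of the three rows of lookahead in \<open>lax_at_cyc_prod\<close> and the
  1 in the domains of the locale.\<close>

lemma lax_cyc:
  assumes "k \<le> p" "t \<in> W (i + p + 4)"
  shows "lax_at t i (\<lambda>s. cyc_prod p (\<gamma> s) k) (\<beta> k t) (\<beta> k t)"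
  by (rule lax_at_cyc_prod[where N = i and \<beta> = "\<lambda>k. \<beta> k t"])
    (use assms in \<open>auto intro!: lax_L[simplified] lax_U W_le[OF assms(2)]\<close>)

text \<open>Given for k = 0; moving one factor from the left end to the right end changes both sides
  equally.\<close>

lemma beta_diag:
  assumes "k \<le> p" "t \<in> W (m + p + 1)"
  shows "\<beta> k t m = C + cyc_prod p (\<gamma> t) k m m"
  using assms(1)
proof (induction k)
  case 0
  then show ?case using diag_0[OF assms(2)] by simp
next
  case (Suc k)
  then have k: "k < p" by simp
  show ?case
    using Suc beta_Suc[OF k] cyc_prod_diag_Suc[OF k, of "\<gamma> t" m] by (cases m) (simp_all add: L_mat_def)
qed

text \<open>A Lax equation whose two diagonals are that of the matrix itself is the Kostant-Toda
  lattice. Adding C I is harmless, since it commutes with S + b.\<close>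

lemma Darboux_mat_derivative:
  assumes k: "k \<le> p" and i: "t \<in> W (i + p + 4)" and j: "t \<in> W (j + p + 1)"
  defines "K \<equiv> \<lambda>s. Darboux_mat p C (\<gamma> s) k"
  shows "((\<lambda>s. K s i j) has_vector_derivative
    (K t i i - K t j j) * K t i j + K t (i + 1) j - (if j = 0 then 0 else K t i (j - 1))) (at t)"
proof -
  let ?P = "\<lambda>s. cyc_prod p (\<gamma> s) k"
  have K: "K s a c = C * one_imat a c + ?P s a c" for s a c
    by (simp add: K_def Darboux_mat_eq[OF k])
  have diag: "\<beta> k t i = K t i i" "\<beta> k t j = K t j j"
    using beta_diag[OF k W_le[OF i]] beta_diag[OF k j] by (simp_all add: K one_imat_def)
  have "((\<lambda>s. ?P s i j) has_vector_derivative \<beta> k t i * ?P t i j + ?P t (Suc i) j - ?P t i j * \<beta> k t j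
      - (if j = 0 then 0 else ?P t i (j - 1))) (at t)"
    using lax_cyc[OF k i] by (simp add: lax_at_def)
  then have "((\<lambda>s. C * one_imat i j + ?P s i j) has_vector_derivative
      0 + (\<beta> k t i * ?P t i j + ?P t (Suc i) j - ?P t i j * \<beta> k t j
      - (if j = 0 then 0 else ?P t i (j - 1)))) (at t)"
    by (intro has_vector_derivative_add has_vector_derivative_const)
  also have "0 + (\<beta> k t i * ?P t i j + ?P t (Suc i) j - ?P t i j * \<beta> k t j
      - (if j = 0 then 0 else ?P t i (j - 1)))
    = (K t i i - K t j j) * K t i j + K t (i + 1) j - (if j = 0 then 0 else K t i (j - 1))"
    unfolding diag by (cases j) (auto simp: K one_imat_def algebra_simps)
  finally show ?thesis by (simp add: K)
qed

text \<open>Column j reaches down to row j + p, and row i needs \<open>W (i + p + 4)\<close>; hence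
  the shift 2 p + 4.\<close>

lemma KT_solution_Darboux_mat:
  assumes k: "k \<le> p"
  shows "KT_solution p (\<lambda>t. Darboux_mat p C (\<gamma> t) k) (\<lambda>j. W (j + 2 * p + 4))"
  unfolding KT_solution_def
proof (intro conjI allI ballI)
  show "banded_hessenberg p (Darboux_mat p C (\<gamma> t) k)" for t
    by (rule banded_hessenberg_Darboux_mat[OF p k])
  show "open_interval (W (j + 2 * p + 4))" for j by (rule W_interval)
  show "(\<Inter>j\<le>N. W (j + 2 * p + 4)) \<noteq> {}" for N
  proof -
    obtain t where "t \<in> W (N + 2 * p + 4)" using W_nonempty by blast
    then have "t \<in> W (j + 2 * p + 4)" if "j \<le> N" for j using that by (elim W_le) simp
    then show ?thesis by blast
  qed
  show "continuous_on (W (j + 2 * p + 4)) (\<lambda>t. Darboux_mat p C (\<gamma> t) k i j)"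
    if i: "i \<in> {j..j + p}" for i j
  proof (intro continuous_at_imp_continuous_on ballI)
    fix t assume "t \<in> W (j + 2 * p + 4)"
    then have "t \<in> W (i + p + 4)" "t \<in> W (j + p + 1)" using i by (auto elim: W_le)
    from has_vector_derivative_continuous[OF Darboux_mat_derivative[OF k this]]
    show "isCont (\<lambda>t. Darboux_mat p C (\<gamma> t) k i j) t" .
  qed
  fix i j t assume "t \<in> KT_eq_dom p (\<lambda>j. W (j + 2 * p + 4)) i j"
  then have "t \<in> W (i + 2 * p + 4)" "t \<in> W (j + 2 * p + 4)"
    by (auto simp: KT_eq_dom_def entry_dom_def)
  then have "t \<in> W (i + p + 4)" "t \<in> W (j + p + 1)" by (auto elim: W_le)
  from Darboux_mat_derivative[OF k this]
  show "((\<lambda>s. Darboux_mat p C (\<gamma> s) k i j) has_vector_derivative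
      (Darboux_mat p C (\<gamma> t) k i i - Darboux_mat p C (\<gamma> t) k j j) * Darboux_mat p C (\<gamma> t) k i j
      + Darboux_mat p C (\<gamma> t) k (i + 1) j
      - (if j = 0 then 0 else Darboux_mat p C (\<gamma> t) k i (j - 1))) (at t)" .
qed

text \<open>From the initial value C + \<gamma>_1, \<open>beta_Suc\<close> slides the window by one
  place as k grows, and \<open>beta_wrap\<close> does so from k = p in row m to k = 0 in row m +
  1.\<close>

lemma beta_window:
  assumes "k \<le> p" "t \<in> W (m + p + 1)" "n = m * (p + 1) + k + 1"
  shows "\<beta> k t m = C + (\<Sum>i\<le>p. if i < n then \<gamma> t (n - i) else 0)"
  using assms
proof (induction m arbitrary: k n)
  case 0
  then show ?case
  proof (induction k arbitrary: n)
    case 0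
    have "(\<Sum>i\<le>p. if i < n then \<gamma> t (n - i) else 0) = (\<Sum>i\<le>p. if i = 0 then \<gamma> t 1 else 0)"
      using 0 by (intro sum.cong) auto
    then show ?case using beta_0 0 by simp
  next
    case (Suc k)
    have n: "n = Suc (Suc k)" using Suc.prems by simp
    show ?case
      unfolding n using Suc.IH[of "Suc k"] Suc.prems beta_Suc[of k t 0]
        window_sum_Suc[where g = "\<gamma> t" and n = "Suc k" and p = p] by simp
  qed
next
  case (Suc m)
  have tm: "t \<in> W (m + p + 1)" using Suc.prems by (auto elim: W_le)
  show ?case
    using Suc.prems
  proof (induction k arbitrary: n)
    case 0
    let ?n = "m * (p + 1) + p + 1"
    have "n = Suc ?n" "?n - p = m * (p + 1) + 1" "p < ?n" "Suc m * (p + 1) + 1 = Suc ?n"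
      using 0 by auto
    then show ?case
      using Suc.IH[OF order_refl tm refl] beta_wrap[OF tm]
        window_sum_Suc[where g = "\<gamma> t" and n = ?n and p = p]
      by (simp add: add_ac)
  next
    case (Suc k)
    let ?n = "Suc m * (p + 1) + k + 1"
    have kp: "k < p" and "n = Suc ?n" "?n - p = m * (p + 1) + Suc k + 1" "p < ?n"
      "Suc m * (p + 1) + Suc k + 1 = Suc ?n"
      using Suc.prems by auto
    then show ?case
      using Suc.IH[OF _ Suc.prems(2) refl] beta_Suc[OF kp, of t "Suc m"]
        window_sum_Suc[where g = "\<gamma> t" and n = ?n and p = p]
      by (simp add: add_ac)
  qed
qed

text \<open>With n - 1 = m (p + 1) + k, \<gamma>_n belongs to U for k = 0 and to L^(k) otherwise.
  Its derivative is \<gamma>_n times a difference of two diagonal entries, whose windows end at n +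
  p and at n.\<close>

lemma gamma_derivative:
  assumes n: "n \<ge> 1" and t: "t \<in> W (n + p + p)"
  shows "((\<lambda>s. \<gamma> s n) has_vector_derivative
    \<gamma> t n * ((\<Sum>i=1..p. \<gamma> t (n + i)) - (\<Sum>i=1..p. if i < n then \<gamma> t (n - i) else 0))) (at t)"
proof -
  define m k where "m = (n - 1) div (p + 1)" and "k = (n - 1) mod (p + 1)"
  have nmk: "n = m * (p + 1) + k + 1"
    using n div_mult_mod_eq[of "n - 1" "p + 1"] by (simp add: m_def k_def)
  have kp: "k \<le> p" using mod_less_divisor[of "p + 1" "n - 1"] by (simp add: k_def)
  have "m + 1 \<le> n" using nmk by simp
  then have tm: "t \<in> W (m + p + 1)" "t \<in> W (Suc m + p + 1)"
    using t p by (auto elim: W_le)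
  show ?thesis
    unfolding window_sum_diff[OF n, symmetric]
  proof (cases k)
    case 0
    have "\<beta> p t m - \<beta> 0 t m = (\<Sum>i\<le>p. if i < n + p then \<gamma> t (n + p - i) else 0)
        - (\<Sum>i\<le>p. if i < n then \<gamma> t (n - i) else 0)"
      using beta_window[OF order_refl tm(1), of "n + p"] beta_window[OF _ tm(1), of 0 n] nmk 0 by simp
    then show "((\<lambda>s. \<gamma> s n) has_vector_derivative
        \<gamma> t n * ((\<Sum>i\<le>p. if i < n + p then \<gamma> t (n + p - i) else 0)
          - (\<Sum>i\<le>p. if i < n then \<gamma> t (n - i) else 0))) (at t)"
      using gamma_U[OF tm(1)] nmk 0 by simp
  next
    case (Suc k')
    have "\<beta> k' t (Suc m) - \<beta> (Suc k') t m = (\<Sum>i\<le>p. if i < n + p then \<gamma> t (n + p - i) else 0)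
        - (\<Sum>i\<le>p. if i < n then \<gamma> t (n - i) else 0)"
      using beta_window[OF _ tm(2), of k' "n + p"] beta_window[OF _ tm(1), of k n] nmk Suc kp by simp
    then show "((\<lambda>s. \<gamma> s n) has_vector_derivative
        \<gamma> t n * ((\<Sum>i\<le>p. if i < n + p then \<gamma> t (n + p - i) else 0)
          - (\<Sum>i\<le>p. if i < n then \<gamma> t (n - i) else 0))) (at t)"
      using gamma_L[OF _ tm(1), of k'] nmk Suc kp by simp
  qed
qed

lemma gamma_continuous:
  assumes n: "n \<ge> 1"
  shows "continuous_on (W (n + p)) (\<lambda>t. \<gamma> t n)"
proof (intro continuous_at_imp_continuous_on ballI)
  fix t assume t: "t \<in> W (n + p)"
  define m k where "m = (n - 1) div (p + 1)" and "k = (n - 1) mod (p + 1)"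
  have nmk: "n = m * (p + 1) + k + 1"
    using n div_mult_mod_eq[of "n - 1" "p + 1"] by (simp add: m_def k_def)
  have kp: "k \<le> p" using mod_less_divisor[of "p + 1" "n - 1"] by (simp add: k_def)
  have tm: "t \<in> W (m + p + 1)" using t nmk by (auto elim!: W_le)
  show "isCont (\<lambda>t. \<gamma> t n) t"
  proof (cases k)
    case 0
    then show ?thesis using has_vector_derivative_continuous[OF gamma_U[OF tm]] nmk by simp
  next
    case (Suc k')
    then show ?thesis using has_vector_derivative_continuous[OF gamma_L[OF _ tm, of k']] nmk kp by simp
  qed
qed

lemma dKdV_solution_gamma:
  "dKdV_solution p (\<lambda>t. Gamma_mat p (\<gamma> t)) (\<lambda>n. W (n + p))"
  unfolding dKdV_solution_def
proof (intro exI[of _ \<gamma>] conjI allI impI ballI refl)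
  show "open_interval (W (n + p))" for n by (rule W_interval)
  show "(\<Inter>n\<in>{1..N}. W (n + p)) \<noteq> {}" for N
  proof -
    obtain t where "t \<in> W (N + p)" using W_nonempty by blast
    then have "t \<in> W (n + p)" if "n \<in> {1..N}" for n using that by (elim W_le) simp
    then show ?thesis by blast
  qed
  show "continuous_on (W (n + p)) (\<lambda>t. \<gamma> t n)" if "n \<ge> 1" for n
    by (rule gamma_continuous[OF that])
  fix n t assume n: "1 \<le> n" and "t \<in> (\<Inter>k\<in>{k. 1 \<le> k \<and> n \<le> k + p \<and> k \<le> n + p}. W (k + p))"
  \<comment> \<open>The index n + p belongs to the intersection and carries the smallest
    domain.\<close>
  then have "t \<in> W (n + p + p)" by auto
  from gamma_derivative[OF n this]
  show "((\<lambda>s. \<gamma> s n) has_vector_derivative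
    \<gamma> t n * ((\<Sum>i=1..p. \<gamma> t (n + i)) - (\<Sum>i=1..p. if i < n then \<gamma> t (n - i) else 0))) (at t)" .
qed

end

section \<open>The given lattice solution and the assembly\<close>

lemma lax_hessenberg_KT:
  assumes p: "p \<ge> 1" and KT: "KT_solution p J D"
    and low: "\<forall>i. \<forall>t\<in>D i. J t (p + i) i \<noteq> 0"
    and det: "\<forall>n. \<forall>t\<in>(\<Inter>j<n. D j). Determinant.det (leading (J t) n - C \<cdot>\<^sub>m 1\<^sub>m n) \<noteq> 0"
  shows "lax_hessenberg p (\<lambda>t i j. J t i j - C * one_imat i j) (\<lambda>t m. J t m m) (\<lambda>t m. J t m m)
    (\<lambda>N. \<Inter>j\<le>N. D j)"
proof
  have hess: "hess 1 p (J t)" for t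
    using KT by (simp add: KT_solution_def banded_hessenberg_iff_hess)
  note zero = hess_zero[OF hess] and one = hess_diag[OF hess, simplified]
  have ivl: "open_interval (D j)" for j using KT by (simp add: KT_solution_def)
  show "open_interval (\<Inter>j\<le>m. D j)" for m
    using ivl by (auto simp: open_interval_def is_interval_convex_1 intro!: open_INT convex_INT)
  show "(\<Inter>j\<le>Suc m. D j) \<subseteq> (\<Inter>j\<le>m. D j)" for m by auto
  show "hess 1 p (\<lambda>i j. J t i j - C * one_imat i j)" for t
    using hess[of t] p by (auto simp: hess_def one_imat_def)
  show "J t (j + p) j - C * one_imat (j + p) j \<noteq> 0" if "t \<in> (\<Inter>k\<le>j + p. D k)" for t j
    using low that p by (auto simp: one_imat_def add.commute)
  show "Determinant.det (leading (\<lambda>i j. J t i j - C * one_imat i j) n) \<noteq> 0"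
    if "t \<in> (\<Inter>j\<le>n. D j)" for t n
  proof -
    have "leading (\<lambda>i j. J t i j - C * one_imat i j) n = leading (J t) n - C \<cdot>\<^sub>m 1\<^sub>m n"
      by (rule eq_matI) (auto simp: leading_def one_imat_def)
    then show ?thesis using det that by auto
  qed
  show "continuous_on (\<Inter>j\<le>m. D j) (\<lambda>t. J t m m)" for m
  proof (rule continuous_on_subset)
    show "continuous_on (D m) (\<lambda>t. J t m m)" using KT by (simp add: KT_solution_def)
  qed auto
  show "lax_at t i (\<lambda>t i j. J t i j - C * one_imat i j) (\<lambda>m. J t m m) (\<lambda>m. J t m m)"
    if t: "t \<in> (\<Inter>j\<le>i. D j)" for t i
    unfolding lax_at_def
  proof
    fix j
    let ?X = "\<lambda>s i j. J s i j - C * one_imat i j"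
    show "((\<lambda>s. ?X s i j) has_vector_derivative J t i i * ?X t i j + ?X t (Suc i) j - ?X t i j * J t j j
        - (if j = 0 then 0 else ?X t i (j - 1))) (at t)"
    proof (cases "j \<le> i")
      case True
      then have "t \<in> KT_eq_dom p D i j"
        using t by (auto simp: KT_eq_dom_def entry_dom_def)
      then have "((\<lambda>s. J s i j) has_vector_derivative (J t i i - J t j j) * J t i j + J t (i + 1) j
          - (if j = 0 then 0 else J t i (j - 1))) (at t)"
        using KT by (simp add: KT_solution_def)
      then have "((\<lambda>s. J s i j - C * one_imat i j) has_vector_derivative
          ((J t i i - J t j j) * J t i j + J t (i + 1) j - (if j = 0 then 0 else J t i (j - 1))) - 0) (at t)"
        by (intro has_vector_derivative_diff has_vector_derivative_const)
      also have "((J t i i - J t j j) * J t i j + J t (i + 1) j - (if j = 0 then 0 else J t i (j - 1))) - 0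
        = J t i i * ?X t i j + ?X t (Suc i) j - ?X t i j * J t j j - (if j = 0 then 0 else ?X t i (j - 1))"
        using True by (cases j) (auto simp: one_imat_def algebra_simps)
      finally show ?thesis .
    next
      case False
      \<comment> \<open>Above the diagonal the entries are constant and the right side cancels
        identically, even if t lies outside \<open>D j\<close>.\<close>
      then consider "j = Suc i" | "j = Suc (Suc i)" | "j > Suc (Suc i)" by linarith
      then show ?thesis
      proof cases
        case 3
        then have "i + 1 < j - 1" by simp
        with 3 show ?thesis by (simp add: one_imat_def zero)
      qed (simp_all add: one_imat_def one zero)
    qed
  qed
qed

theorem theorem1:
  fixes p :: nat and J :: "real \<Rightarrow> complex imat" and D :: "nat \<Rightarrow> real set" and C :: complex
  assumes "p \<ge> 1"
    and "KT_solution p J D"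
    and "\<forall>i. \<forall>t\<in>D i. J t (p + i) i \<noteq> 0"
    and "\<forall>n. \<forall>t\<in>(\<Inter>j<n. D j).
           Determinant.det (leading (J t) n - C \<cdot>\<^sub>m 1\<^sub>m n) \<noteq> 0"
  shows "\<exists>(K :: nat \<Rightarrow> real \<Rightarrow> complex imat) (DK :: nat \<Rightarrow> nat \<Rightarrow> real set)
            (\<gamma> :: real \<Rightarrow> nat \<Rightarrow> complex) (E :: nat \<Rightarrow> real set).
           K 0 = J \<and> DK 0 = D \<and>
           (\<forall>k\<in>{1..p}. KT_solution p (K k) (DK k)) \<and>
           formal_Darboux_identities p C K DK \<gamma> E \<and>
           dKdV_solution p (\<lambda>t. Gamma_mat p (\<gamma> t)) E"
proof -
  define W where "W N = (\<Inter>j\<le>N. D j)" for N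
  have W_ne: "W N \<noteq> {}" for N
    using assms(2) by (simp add: KT_solution_def W_def)
  interpret X: lax_hessenberg p "\<lambda>t i j. J t i j - C * one_imat i j" "\<lambda>t m. J t m m" "\<lambda>t m. J t m m" W
    unfolding W_def by (rule lax_hessenberg_KT[OF assms])
  obtain Xs \<beta> l where Xs0: "Xs 0 = (\<lambda>t i j. J t i j - C * one_imat i j)"
    and \<beta>0: "\<beta> 0 = (\<lambda>t m. J t m m)"
    and lh: "\<forall>k\<le>p. lax_hessenberg (p - k) (Xs k) (\<beta> k) (\<lambda>t m. J t m m) (\<lambda>m. W (m + k))"
    and \<beta>: "\<forall>k<p. \<forall>t m. \<beta> (Suc k) t m
      = \<beta> k t m + l (Suc k) t m - (if m = 0 then 0 else l (Suc k) t (m - 1))"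
    and dl: "\<forall>k<p. \<forall>m. \<forall>t\<in>W (Suc m + k). ((\<lambda>s. l (Suc k) s m) has_vector_derivative
      l (Suc k) t m * (\<beta> k t (Suc m) - \<beta> (Suc k) t m)) (at t)"
    and fact: "\<forall>k<p. \<forall>m. \<forall>t\<in>W (m + k). \<forall>j. Xs k t m j
      = Xs (Suc k) t m j + (if m = 0 then 0 else l (Suc k) t (m - 1) * Xs (Suc k) t (m - 1) j)"
    using X.bidiagonal_factorization by (elim exE conjE) (rule that)
  note lh = lh[rule_format] and \<beta> = \<beta>[rule_format] and dl = dl[rule_format] and fact = fact[rule_format]
  interpret U: lax_hessenberg 0 "Xs p" "\<beta> p" "\<lambda>t m. J t m m" "\<lambda>m. W (m + p)"
    using lh[OF order_refl] by simp
  \<comment> \<open>The factors are interleaved: k = 0 gives the m-th diagonal entry of U, k \<ge> 1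
    the m-th subdiagonal entry of L^(k).\<close>
  define \<gamma> where "\<gamma> t n = (let m = (n - 1) div (p + 1); k = (n - 1) mod (p + 1) in
    if k = 0 then Xs p t m m else l k t m)" for t n
  have \<gamma>_U: "\<gamma> t (m * (p + 1) + 1) = Xs p t m m" for t m
    by (simp add: \<gamma>_def Let_def del: mult_Suc_right)
  have \<gamma>_L: "\<gamma> t (m * (p + 1) + Suc k + 1) = l (Suc k) t m" if "k < p" for t m k
  proof -
    have "(m * (p + 1) + Suc k) mod (p + 1) = Suc k" "(m * (p + 1) + Suc k) div (p + 1) = m"
      using that by (simp_all only: mod_mult_self3 div_mult_self3) simp_all
    then show ?thesis by (simp add: \<gamma>_def Let_def del: mult_Suc_right)
  qed
  have Xp: "Xs p t = U_mat p (\<gamma> t)" for t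
  proof (intro ext)
    fix i j
    consider "j = i" | "j = Suc i" | "j > i + 1 \<or> i > j + 0" by linarith
    then show "Xs p t i j = U_mat p (\<gamma> t) i j"
    proof cases
      case 1
      then show ?thesis using \<gamma>_U[of t i] by (simp add: U_mat_def)
    next
      case 2
      then show ?thesis using hess_diag[OF U.X_hess, of t i] by (simp add: U_mat_def)
    next
      case 3
      then show ?thesis using hess_zero[OF U.X_hess 3] by (auto simp: U_mat_def)
    qed
  qed
  have Xk: "\<forall>i j. t \<in> W (i + p) \<longrightarrow> Xs k t i j = times_imat (L_prod p (\<gamma> t) k p) (U_mat p (\<gamma> t)) i j"
    if "k \<le> p" for k t
    using that
  proof (induction k rule: inc_induct)
    case base
    then show ?case by (simp add: times_one_left Xp)
  next
    case (step k)
    show ?case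
    proof (intro allI impI)
      fix i j assume t: "t \<in> W (i + p)"
      let ?Y = "times_imat (L_prod p (\<gamma> t) (Suc k) p) (U_mat p (\<gamma> t))"
      have "hess 0 (p - Suc k) (L_prod p (\<gamma> t) (Suc k) p)"
        using step.hyps by (intro hess_L_prod) simp
      then have "times_imat (L_prod p (\<gamma> t) k p) (U_mat p (\<gamma> t)) = times_imat (L_mat p (\<gamma> t) (Suc k)) ?Y"
        using step.hyps by (simp add: L_prod_rec_left times_imat_assoc[OF hess_L])
      moreover have "Xs k t i j = Xs (Suc k) t i j
          + (if i = 0 then 0 else l (Suc k) t (i - 1) * Xs (Suc k) t (i - 1) j)"
        using step.hyps t by (intro fact X.T_le[OF t]) auto
      moreover have "Xs (Suc k) t i j = ?Y i j" "Xs (Suc k) t (i - 1) j = ?Y (i - 1) j"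
        using step.IH X.T_le[OF t, of "i - 1 + p"] t by auto
      moreover have "i \<noteq> 0 \<Longrightarrow> L_mat p (\<gamma> t) (Suc k) i (i - 1) = l (Suc k) t (i - 1)"
        using \<gamma>_L[OF step.hyps(2), of t "i - 1"] by (simp add: L_mat_def)
      ultimately show "Xs k t i j = times_imat (L_prod p (\<gamma> t) k p) (U_mat p (\<gamma> t)) i j"
        by (simp add: times_L_left)
    qed
  qed
  have J: "J t i j = C * one_imat i j + cyc_prod p (\<gamma> t) 0 i j" if "t \<in> W (i + p)" for t i j
    using Xk[of 0 t] that by (auto simp: Xs0 cyc_prod_def times_one_right[OF hess_U] algebra_simps)
  interpret F: bidiagonal_flow p C \<gamma> \<beta> W
  proof
    show "p \<ge> 1" by (rule assms(1))
    show "open_interval (W n)" for n by (rule X.T_interval)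
    show "W n \<subseteq> W m" if "m \<le> n" for m n by (rule X.T_antimono[OF that])
    show "W n \<noteq> {}" for n by (rule W_ne)
    show "\<beta> (Suc k) t m = \<beta> k t m + \<gamma> t (m * (p + 1) + Suc k + 1)
      - (if m = 0 then 0 else \<gamma> t ((m - 1) * (p + 1) + Suc k + 1))" if "k < p" for k t m
      unfolding \<gamma>_L[OF that] by (rule \<beta>[OF that])
    show "((\<lambda>s. \<gamma> s (m * (p + 1) + Suc k + 1)) has_vector_derivative
        \<gamma> t (m * (p + 1) + Suc k + 1) * (\<beta> k t (Suc m) - \<beta> (Suc k) t m)) (at t)"
      if "k < p" "t \<in> W (m + p + 1)" for k t m
      unfolding \<gamma>_L[OF that(1)] by (rule dl[OF that(1) X.T_le[OF that(2)]]) (use that in simp)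
    fix t m assume t: "t \<in> W (m + p + 1)"
    have tm: "t \<in> W (m + p)" using X.T_le[OF t] by simp
    have lax: "((\<lambda>s. Xs p s m j) has_vector_derivative \<beta> p t m * Xs p t m j + Xs p t (Suc m) j
        - Xs p t m j * \<beta> 0 t j - (if j = 0 then 0 else Xs p t m (j - 1))) (at t)" for j
      using U.X_lax[OF tm] by (simp add: lax_at_def \<beta>0)
    show "((\<lambda>s. \<gamma> s (m * (p + 1) + 1)) has_vector_derivative
        \<gamma> t (m * (p + 1) + 1) * (\<beta> p t m - \<beta> 0 t m)) (at t)"
      using lax[of m] hess_zero[OF U.X_hess, of "Suc m" m t] hess_zero[OF U.X_hess, of m "m - 1" t]
      unfolding \<gamma>_U by (cases m) (simp_all add: algebra_simps)
    \<comment> \<open>The superdiagonal is constantly 1, so the right side of its Lax equation is 0;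
      this is the wrap-around relation.\<close>
    have "Xs p s m (Suc m) = 1" for s using hess_diag[OF U.X_hess, of s m] by simp
    then have "((\<lambda>s. 1) has_vector_derivative \<beta> p t m + Xs p t (Suc m) (Suc m) - \<beta> 0 t (Suc m) - Xs p t m m) (at t)"
      using lax[of "Suc m"] by simp
    from vector_derivative_unique_at[OF this has_vector_derivative_const]
    show "\<beta> 0 t (Suc m) = \<beta> p t m + \<gamma> t (Suc m * (p + 1) + 1) - \<gamma> t (m * (p + 1) + 1)"
      unfolding \<gamma>_U by (simp add: algebra_simps)
    show "\<beta> 0 t m = C + cyc_prod p (\<gamma> t) 0 m m"
      using J[OF tm] by (simp add: \<beta>0 one_imat_def)
  next
    fix t assume "t \<in> W (p + 1)"
    then have t: "t \<in> W p" by (rule X.T_le) simp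
    \<comment> \<open>Unit lower triangular factors on the left do not change row 0.\<close>
    have "Xs k t 0 0 = Xs p t 0 0" if "k \<le> p" for k
      using that by (induction k rule: inc_induct) (use fact[of _ t 0] X.T_le[OF t] in auto)
    from this[of 0] show "\<beta> 0 t 0 = C + \<gamma> t 1"
      using \<gamma>_U[of t 0] by (simp add: \<beta>0 Xs0 one_imat_def algebra_simps)
  qed
  \<comment> \<open>\<open>K 0\<close> is J itself, because J equals its product of factors only on
    the relevant domains.\<close>
  define K where "K k = (if k = 0 then J else (\<lambda>t. Darboux_mat p C (\<gamma> t) k))" for k
  define DK where "DK k = (if k = 0 then D else (\<lambda>j. W (j + 2 * p + 4)))" for k :: nat
  have "formal_Darboux_identities p C K DK \<gamma> (\<lambda>n. W (n + p))"
    unfolding formal_Darboux_identities_def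
  proof
    fix N
    let ?V = "W ((N + 1) * (p + 1) + N + 2 * p + 4)"
    have V: "t \<in> W n" if "t \<in> ?V" "n \<le> (N + 1) * (p + 1) + N + 2 * p + 4" for t n
      using X.T_le[OF that] .
    show "\<exists>V. open_interval V \<and> V \<noteq> {} \<and> V \<subseteq> (\<Inter>n\<in>{1..(N + 1) * (p + 1)}. W (n + p)) \<and>
        (\<forall>k\<le>p. V \<subseteq> (\<Inter>j\<le>N. DK k j) \<and>
           (\<forall>t\<in>V. \<forall>i\<le>N. \<forall>j\<le>N. K k t i j = Darboux_mat p C (\<gamma> t) k i j))"
    proof (intro exI[of _ ?V] conjI allI impI ballI)
      show "open_interval ?V" "?V \<noteq> {}" by (rule X.T_interval W_ne)+
      show "?V \<subseteq> (\<Inter>n\<in>{1..(N + 1) * (p + 1)}. W (n + p))"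
        using V by auto
      show "?V \<subseteq> (\<Inter>j\<le>N. DK k j)" for k
      proof (cases "k = 0")
        case True
        have "W N \<subseteq> (\<Inter>j\<le>N. D j)" by (simp add: W_def)
        then show ?thesis using True V[of _ N] by (auto simp: DK_def)
      next
        case False
        then show ?thesis using V by (auto simp: DK_def)
      qed
      fix k t i j assume "t \<in> ?V" "i \<le> N"
      then have "t \<in> W (i + p)" using V by auto
      then show "K k t i j = Darboux_mat p C (\<gamma> t) k i j"
        using J by (simp add: K_def Darboux_mat_eq)
    qed
  qed
  moreover have "\<forall>k\<in>{1..p}. KT_solution p (K k) (DK k)"
    using F.KT_solution_Darboux_mat by (simp add: K_def DK_def)
  moreover have "K 0 = J" "DK 0 = D" by (simp_all add: K_def DK_def)
  ultimately show ?thesis using F.dKdV_solution_gamma by blast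
qed

end
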